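(* The family $\{\mu_{\hat\sigma}^\Lambda:\Lambda\in\mathcal{O}_c(X)\}$ is consistent, i.e. $\mu_{\hat\sigma}^{\Lambda_2}\circ p_{\Lambda_2,\Lambda_1}^{-1}=\mu_{\hat\sigma}^{\Lambda_1}$ for all $\Lambda_1,\Lambda_2\in\mathcal{O}_c(X)$ with $\Lambda_1\subset\Lambda_2$, and there exists a unique probability measure $\mu_{\hat\sigma}$ (the marked Poisson measure) on $\mathcal{B}(\Omega_X^M)$ such that for every $\Lambda\in\mathcal{O}_c(X)$ the image of $\mu_{\hat\sigma}$ under $p_\Lambda:\Omega_X^M\to\Omega_\Lambda^M$ is $\mu_{\hat\sigma}^\Lambda$.
   Context: $X$ is a connected, oriented, non-compact $C^\infty$ Riemannian manifold with a non-atomic Radon measure $\sigma$; $M$ is a complete separable metric space with a probability measure $\tau$; $\hat\sigma:=\sigma\otimes\tau$ on $X\times M$. $\mathcal{O}_c(X)$ is the family of open subsets of $X$ with compact closure. $\Gamma_X$ is the set of subsets $\gamma\subset X$ with $|\gamma\cap K|<\infty$ for every compact $K\subset X$, and $\Gamma_\Lambda$ is the set of those $\gamma\in\Gamma_X$ contained in $\Lambda\subset X$. The marked configuration space is $\Omega_X^M=\{\omega=(\gamma_\omega,m_\omega): \gamma_\omega\in\Gamma_X,\ m_\omega:\gamma_\omega\to M\}$ ($m_\omega$ any map). For $\Lambda\in\mathcal{O}_c(X)$, $\Omega_\Lambda^M=\{(\gamma_\omega,m_\omega):\gamma_\omega\in\Gamma_\Lambda,\ m_\omega:\gamma_\omega\to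 M\}=\bigsqcup_{n\ge0}\Omega_\Lambda^M(n)$, where $\Omega_\Lambda^M(n)$ consists of those with $|\gamma_\omega|=n$ and $\Omega_\Lambda^M(0)=\{\emptyset\}$. $\Omega_\Lambda^M(n)$ is identified with the set of classes in $(\Lambda\times M)^n/\mathfrak{S}_n$ ($\mathfrak{S}_n$ the permutation group) of $n$-tuples $((x_1,m_1),\dots,(x_n,m_n))$ with pairwise distinct $x_i$, with the relative metric from the quotient metric $\delta([x],[y])=\inf_{x'\in[x],y'\in[y]}d^n(x',y')$, where $d^n$ is the metric on $(\Lambda\times M)^n$ coming from the metrics of $X$ and $M$. $\Omega_\Lambda^M$ has the disjoint union topology and the corresponding Borel $\sigma$-algebra $\mathcal{B}(\Omega_\Lambda^M)$. The restriction maps are $p_\Lambda:\Omega_X^M\to\Omega_\Lambda^M$, $p_\Lambda(\gamma_\omega,m_\omega)=(\gamma_\omega\cap\Lambda,\,m_\omega|_{\gamma_\omega\cap\Lambda})$, and for $\Lambda_1\subset\Lambda_2$ the maps $p_{\Lambda_2,\Lambda_1}:\Omega_{\Lambda_2}^M\to\Omega_{\Lambda_1}^M$ are given by the same formula with $\Lambda=\Lambda_1$. $\Omega_X^M$ carries the weakest topology making all $p_\Lambda$, $\Lambda\in\mathcal{O}_c(X)$, continuous, and $\mathcal{B}(\Omega_X^M)$ is the associated Borel $\sigma$-algebra. For $\Lambda\in\mathcal{O}_c(X)$ and $n\ge1$, $\hat\sigma_{\Lambda,n}$ is the measure on $\Omega_\Lambda^M(n)$ induced by $\frac1{n!}(\sigma\otimes\tau)^{n}$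 on $(\Lambda\times M)^n$, and $\hat\sigma_{\Lambda,0}(\{\emptyset\})=1$. Set $\lambda_{\hat\sigma}^\Lambda=\sum_{n\ge0}\hat\sigma_{\Lambda,n}$, a finite measure on $\Omega_\Lambda^M$ of total mass $e^{\sigma(\Lambda)}$, and $\mu_{\hat\sigma}^\Lambda:=e^{-\sigma(\Lambda)}\lambda_{\hat\sigma}^\Lambda$, a probability measure.
   Formalization: B(Ω_X^M) is taken as the σ-algebra generated by the sets p_Λ^{-1}(U), U open in Ω_Λ^M, not by all open sets of the weakest topology; with the latter, existence fails under CH (e.g. X = R, σ Lebesgue), as events "one point in Λ, lying in A" are open for every A ⊂ Λ. *)

theory Defs
  imports "HOL-Probability.Probability_Measure"
begin

section \<open>Oriented Riemannian manifolds\<close>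

text \<open>Meant for open \<open>S\<close>: derivatives are taken in the full space, along fixed vectors \<open>v\<close>.\<close>

primrec Ck_on :: "nat \<Rightarrow> ('a::real_normed_vector \<Rightarrow> 'b::real_normed_vector) \<Rightarrow> 'a set \<Rightarrow> bool"
  where
    "Ck_on 0 f S \<longleftrightarrow> continuous_on S f"
  | "Ck_on (Suc k) f S \<longleftrightarrow>
       (\<forall>x\<in>S. f differentiable (at x)) \<and> (\<forall>v. Ck_on k (\<lambda>x. frechet_derivative f (at x) v) S)"

definition smooth_on :: "('a::real_normed_vector \<Rightarrow> 'b::real_normed_vector) \<Rightarrow> 'a set \<Rightarrow> bool"
  where "smooth_on f S \<longleftrightarrow> (\<forall>k. Ck_on k f S)"

type_synonym ('x, 'n) chart = "'x set \<times> ('x \<Rightarrow> real^'n)"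

definition chart_inv :: "('x, 'n) chart \<Rightarrow> real^'n \<Rightarrow> 'x"
  where "chart_inv c = inv_into (fst c) (snd c)"

definition is_chart :: "('x::topological_space, 'n::finite) chart \<Rightarrow> bool"
  where "is_chart c \<longleftrightarrow> open (fst c) \<and> open (snd c ` fst c) \<and>
           homeomorphism (fst c) (snd c ` fst c) (snd c) (chart_inv c)"

definition transition :: "('x, 'n) chart \<Rightarrow> ('x, 'n) chart \<Rightarrow> real^'n \<Rightarrow> real^'n"
  where "transition c d = snd d \<circ> chart_inv c"

definition jacobian :: "('x, 'n::finite) chart \<Rightarrow> ('x, 'n) chart \<Rightarrow> 'x \<Rightarrow> real^'n^'n"
  where "jacobian c d x = matrix (frechet_derivative (transition c d) (at (snd c x)))"

text \<open>The orientation is the one determined by the atlas.\<close>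

definition oriented_smooth_atlas :: "('x::topological_space, 'n::finite) chart set \<Rightarrow> bool"
  where "oriented_smooth_atlas \<A> \<longleftrightarrow>
           (\<forall>c\<in>\<A>. is_chart c) \<and> (\<Union>c\<in>\<A>. fst c) = UNIV \<and>
           (\<forall>c\<in>\<A>. \<forall>d\<in>\<A>. smooth_on (transition c d) (snd c ` (fst c \<inter> fst d)) \<and>
              (\<forall>x \<in> fst c \<inter> fst d. det (jacobian c d x) > 0))"

text \<open>\<open>g c x\<close> is the Gram matrix of the inner product on the tangent space at \<open>x\<close> in the
  coordinates of the chart \<open>c\<close>.\<close>

definition riemannian_metric ::
  "('x::topological_space, 'n::finite) chart set \<Rightarrow> (('x, 'n) chart \<Rightarrow> 'x \<Rightarrow> real^'n^'n) \<Rightarrow> bool"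
  where "riemannian_metric \<A> g \<longleftrightarrow>
           (\<forall>c\<in>\<A>. smooth_on (\<lambda>y. g c (chart_inv c y)) (snd c ` fst c) \<and>
              (\<forall>x\<in>fst c. transpose (g c x) = g c x \<and> (\<forall>v. v \<noteq> 0 \<longrightarrow> v \<bullet> (g c x *v v) > 0))) \<and>
           (\<forall>c\<in>\<A>. \<forall>d\<in>\<A>. \<forall>x\<in>fst c \<inter> fst d.
              g c x = transpose (jacobian c d x) ** g d x ** jacobian c d x)"

definition C1_curve_on ::
  "('x::topological_space, 'n::finite) chart set \<Rightarrow> (real \<Rightarrow> 'x) \<Rightarrow> real \<Rightarrow> real \<Rightarrow> bool"
  where "C1_curve_on \<A> \<gamma> a b \<longleftrightarrow> continuous_on {a..b} \<gamma> \<and>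
           (\<forall>c\<in>\<A>. \<exists>D. continuous_on {t\<in>{a..b}. \<gamma> t \<in> fst c} D \<and>
              (\<forall>t\<in>{a..b}. \<gamma> t \<in> fst c \<longrightarrow>
                 ((snd c \<circ> \<gamma>) has_vector_derivative D t) (at t within {a..b})))"

definition piecewise_C1_curve ::
  "('x::topological_space, 'n::finite) chart set \<Rightarrow> (real \<Rightarrow> 'x) \<Rightarrow> bool"
  where "piecewise_C1_curve \<A> \<gamma> \<longleftrightarrow> continuous_on {0..1} \<gamma> \<and>
           (\<exists>S. finite S \<and>
              (\<forall>a b. 0 \<le> a \<and> a < b \<and> b \<le> 1 \<and> {a<..<b} \<inter> S = {} \<longrightarrow> C1_curve_on \<A> \<gamma> a b))"

text \<open>By the transformation law of \<open>g\<close> the speed does not depend on the chosen chart; it is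
  only meaningful where \<open>\<gamma>\<close> is differentiable, that is, off finitely many parameters.\<close>

definition speed ::
  "('x, 'n::finite) chart set \<Rightarrow> (('x, 'n) chart \<Rightarrow> 'x \<Rightarrow> real^'n^'n) \<Rightarrow> (real \<Rightarrow> 'x) \<Rightarrow> real \<Rightarrow> real"
  where "speed \<A> g \<gamma> t =
           (let c = (SOME c. c \<in> \<A> \<and> \<gamma> t \<in> fst c); v = vector_derivative (snd c \<circ> \<gamma>) (at t)
            in sqrt (v \<bullet> (g c (\<gamma> t) *v v)))"

definition curve_length ::
  "('x, 'n::finite) chart set \<Rightarrow> (('x, 'n) chart \<Rightarrow> 'x \<Rightarrow> real^'n^'n) \<Rightarrow> (real \<Rightarrow> 'x) \<Rightarrow> real"
  where "curve_length \<A> g \<gamma> = integral {0..1} (speed \<A> g \<gamma>)"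

definition riemannian_distance ::
  "('x::topological_space, 'n::finite) chart set \<Rightarrow> (('x, 'n) chart \<Rightarrow> 'x \<Rightarrow> real^'n^'n) \<Rightarrow>
    'x \<Rightarrow> 'x \<Rightarrow> real"
  where "riemannian_distance \<A> g x y =
           Inf {curve_length \<A> g \<gamma> | \<gamma>. piecewise_C1_curve \<A> \<gamma> \<and> \<gamma> 0 = x \<and> \<gamma> 1 = y}"

text \<open>The manifold is the whole type \<open>'x\<close>, whose \<open>dist\<close> is required to be the Riemannian
  distance; as the Riemannian distance induces the manifold topology, it is no restriction that
  charts refer to the metric topology of \<open>'x\<close>.\<close>

definition connected_oriented_riemannian_manifold ::
  "('x::{metric_space, second_countable_topology}, 'n::finite) chart set \<Rightarrow>
    (('x, 'n) chart \<Rightarrow> 'x \<Rightarrow> real^'n^'n) \<Rightarrow> bool"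
  where "connected_oriented_riemannian_manifold \<A> g \<longleftrightarrow>
           connected (UNIV :: 'x set) \<and> oriented_smooth_atlas \<A> \<and> riemannian_metric \<A> g \<and>
           (\<forall>x y. dist x y = riemannian_distance \<A> g x y)"

section \<open>Non-atomic Radon measures\<close>

definition radon_measure :: "'a::topological_space measure \<Rightarrow> bool"
  where "radon_measure \<mu> \<longleftrightarrow> sets \<mu> = sets borel \<and> (\<forall>K. compact K \<longrightarrow> emeasure \<mu> K < \<infinity>) \<and>
           (\<forall>B\<in>sets borel. emeasure \<mu> B = (SUP K \<in> {K. compact K \<and> K \<subseteq> B}. emeasure \<mu> K))"

definition atom :: "'a measure \<Rightarrow> 'a set \<Rightarrow> bool"
  where "atom \<mu> A \<longleftrightarrow> A \<in> sets \<mu> \<and> emeasure \<mu> A > 0 \<and>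
           (\<forall>B\<in>sets \<mu>. B \<subseteq> A \<longrightarrow> emeasure \<mu> B = 0 \<or> emeasure \<mu> B = emeasure \<mu> A)"

definition non_atomic :: "'a measure \<Rightarrow> bool"
  where "non_atomic \<mu> \<longleftrightarrow> (\<nexists>A. atom \<mu> A)"

section \<open>Marked configurations\<close>

definition Oc :: "'x::topological_space set set"
  where "Oc = {\<Lambda>. open \<Lambda> \<and> compact (closure \<Lambda>)}"

definition configs :: "'x::topological_space set \<Rightarrow> 'x set set"
  where "configs \<Lambda> = {\<gamma>. (\<forall>K. compact K \<longrightarrow> finite (\<gamma> \<inter> K)) \<and> \<gamma> \<subseteq> \<Lambda>}"

text \<open>The mark map \<open>m\<close> is a function on \<open>\<gamma>\<close> only: it is \<open>undefined\<close> off \<open>\<gamma>\<close>.\<close>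

type_synonym ('x, 'm) mconf = "'x set \<times> ('x \<Rightarrow> 'm)"

definition mconfs :: "'x::topological_space set \<Rightarrow> ('x, 'm) mconf set"
  where "mconfs \<Lambda> = {(\<gamma>, m). \<gamma> \<in> configs \<Lambda> \<and> m \<in> \<gamma> \<rightarrow>\<^sub>E UNIV}"

definition mconfs_n :: "'x::topological_space set \<Rightarrow> nat \<Rightarrow> ('x, 'm) mconf set"
  where "mconfs_n \<Lambda> n = {\<omega> \<in> mconfs \<Lambda>. finite (fst \<omega>) \<and> card (fst \<omega>) = n}"

definition mrestrict :: "'x set \<Rightarrow> ('x, 'm) mconf \<Rightarrow> ('x, 'm) mconf"
  where "mrestrict \<Lambda> \<omega> = (fst \<omega> \<inter> \<Lambda>, restrict (snd \<omega>) (fst \<omega> \<inter> \<Lambda>))"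

text \<open>Tuples are extensional functions on \<open>{..<n}\<close>. The map \<open>mconf_of n\<close> is the quotient map
  from tuples with distinct positions to marked configurations, and its fibres \<open>tuples_of n \<omega>\<close>
  are the orbits of the permutation group (\<open>tuples_of_orbit\<close> below).\<close>

definition dtuples :: "'x set \<Rightarrow> nat \<Rightarrow> (nat \<Rightarrow> 'x \<times> 'm) set"
  where "dtuples \<Lambda> n = {z \<in> {..<n} \<rightarrow>\<^sub>E \<Lambda> \<times> UNIV. inj_on (fst \<circ> z) {..<n}}"

definition mconf_of :: "nat \<Rightarrow> (nat \<Rightarrow> 'x \<times> 'm) \<Rightarrow> ('x, 'm) mconf"
  where "mconf_of n z =
           ((fst \<circ> z) ` {..<n},
            \<lambda>x \<in> (fst \<circ> z) ` {..<n}. snd (z (THE i. i < n \<and> fst (z i) = x)))"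

definition tuples_of :: "nat \<Rightarrow> ('x, 'm) mconf \<Rightarrow> (nat \<Rightarrow> 'x \<times> 'm) set"
  where "tuples_of n \<omega> = {z \<in> dtuples UNIV n. mconf_of n z = \<omega>}"

definition tuple_dist ::
  "nat \<Rightarrow> (nat \<Rightarrow> 'x::metric_space \<times> 'm::metric_space) \<Rightarrow> (nat \<Rightarrow> 'x \<times> 'm) \<Rightarrow> real"
  where "tuple_dist n z w = L2_set (\<lambda>i. dist (z i) (w i)) {..<n}"

text \<open>The value \<open>0\<close> on non-configurations is a dummy: \<open>Metric_space\<close> wants a distance that is
  non-negative on the whole type.\<close>

definition quot_dist ::
  "nat \<Rightarrow> ('x::metric_space, 'm::metric_space) mconf \<Rightarrow> ('x, 'm) mconf \<Rightarrow> real"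
  where "quot_dist n \<omega> \<eta> =
           (if tuples_of n \<omega> = {} \<or> tuples_of n \<eta> = {} then 0
            else Inf {tuple_dist n z w | z w. z \<in> tuples_of n \<omega> \<and> w \<in> tuples_of n \<eta>})"

definition mconf_topology_n ::
  "'x::metric_space set \<Rightarrow> nat \<Rightarrow> ('x, 'm::metric_space) mconf topology"
  where "mconf_topology_n \<Lambda> n = Metric_space.mtopology (mconfs_n \<Lambda> n) (quot_dist n)"

text \<open>Disjoint union topology; meant for \<open>\<Lambda> \<in> Oc\<close>.\<close>

definition mconf_topology :: "'x::metric_space set \<Rightarrow> ('x, 'm::metric_space) mconf topology"
  where "mconf_topology \<Lambda> =
           topology (\<lambda>U. U \<subseteq> mconfs \<Lambda> \<and> (\<forall>n. openin (mconf_topology_n \<Lambda> n) (U \<inter> mconfs_n \<Lambda> n)))"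

definition borel_of :: "'a topology \<Rightarrow> 'a measure"
  where "borel_of T = sigma (topspace T) {U. openin T U}"

definition cylinders :: "('x::metric_space, 'm::metric_space) mconf set set"
  where "cylinders = {mrestrict \<Lambda> -` U \<inter> mconfs UNIV | \<Lambda> U. \<Lambda> \<in> Oc \<and> openin (mconf_topology \<Lambda>) U}"

text \<open>The measurable structure of the space of all marked configurations is generated by the
  subbase \<open>cylinders\<close> of the weakest topology making all restriction maps to \<open>\<Lambda> \<in> Oc\<close>
  continuous; equivalently it is the smallest one making all these maps measurable to the Borel
  spaces. It is not the \<open>\<sigma>\<close>-algebra of all open sets of that topology: by the lemma
  \<open>one_point_sets_open\<close> below, the latter contains, for every subset \<open>A\<close> of \<open>\<Lambda>\<close> however
  non-measurable, the event that the configuration has exactly one point in \<open>\<Lambda>\<close> and that point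
  lies in \<open>A\<close>. A measure on it with the Poisson marginals would induce a non-zero finite measure
  on all subsets of \<open>\<Lambda>\<close> vanishing on points (as soon as \<open>\<sigma> \<Lambda> > 0\<close>), and the continuum
  hypothesis rules out such measures (Banach-Kuratowski).\<close>

definition mconf_space :: "('x::metric_space, 'm::metric_space) mconf measure"
  where "mconf_space = sigma (mconfs UNIV) cylinders"

section \<open>Lebesgue-Poisson and Poisson measures\<close>

text \<open>For \<open>n = 0\<close> the product measure is the unit mass at the empty tuple, so that
  \<open>lebesgue_poisson_n\<close> is the unit mass at the empty configuration.\<close>

definition lebesgue_poisson_n ::
  "'x::metric_space measure \<Rightarrow> 'm::metric_space measure \<Rightarrow> 'x set \<Rightarrow> nat \<Rightarrow> ('x, 'm) mconf measure"
  where "lebesgue_poisson_n \<sigma> \<tau> \<Lambda> n =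
           distr
             (restrict_space
               (scale_measure (1 / fact n) (\<Pi>\<^sub>M i\<in>{..<n}. restrict_space \<sigma> \<Lambda> \<Otimes>\<^sub>M \<tau>)) (dtuples \<Lambda> n))
             (borel_of (mconf_topology_n \<Lambda> n)) (mconf_of n)"

definition lebesgue_poisson ::
  "'x::metric_space measure \<Rightarrow> 'm::metric_space measure \<Rightarrow> 'x set \<Rightarrow> ('x, 'm) mconf measure"
  where "lebesgue_poisson \<sigma> \<tau> \<Lambda> =
           measure_of (mconfs \<Lambda>) (sets (borel_of (mconf_topology \<Lambda>)))
             (\<lambda>B. \<Sum>n. emeasure (lebesgue_poisson_n \<sigma> \<tau> \<Lambda> n) (B \<inter> mconfs_n \<Lambda> n))"

definition marked_poisson_on ::
  "'x::metric_space measure \<Rightarrow> 'm::metric_space measure \<Rightarrow> 'x set \<Rightarrow> ('x, 'm) mconf measure"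
  where "marked_poisson_on \<sigma> \<tau> \<Lambda> =
           scale_measure (ennreal (exp (- measure \<sigma> \<Lambda>))) (lebesgue_poisson \<sigma> \<tau> \<Lambda>)"

section \<open>Basic facts about the definitions\<close>

lemma mconf_of_apply:
  assumes "z \<in> dtuples \<Lambda> n" "i < n"
  shows "snd (mconf_of n z) (fst (z i)) = snd (z i)"
proof -
  have "(THE j. j < n \<and> fst (z j) = fst (z i)) = i"
    using assms by (intro the_equality) (auto simp: dtuples_def inj_on_def)
  then show ?thesis using assms(2) by (auto simp: mconf_of_def)
qed

lemma mconf_of_eqI:
  assumes z: "z \<in> dtuples \<Lambda> n" and w: "w \<in> dtuples \<Lambda>' n" and eq: "z ` {..<n} = w ` {..<n}"
  shows "mconf_of n z = mconf_of n w"
proof -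
  have f: "(fst \<circ> z) ` {..<n} = (fst \<circ> w) ` {..<n}"
    using eq by (metis image_comp)
  have "snd (mconf_of n z) x = snd (mconf_of n w) x" for x
  proof (cases "x \<in> (fst \<circ> z) ` {..<n}")
    case True
    then obtain i where i: "i < n" "x = fst (z i)" by auto
    then obtain j where j: "j < n" "z i = w j" using eq by (metis imageE imageI lessThan_iff)
    show ?thesis using mconf_of_apply[OF z i(1)] mconf_of_apply[OF w j(1)] i j by simp
  next
    case False
    then show ?thesis using f by (simp add: mconf_of_def)
  qed
  then have "snd (mconf_of n z) = snd (mconf_of n w)" by blast
  moreover have "fst (mconf_of n z) = fst (mconf_of n w)" using f by (simp add: mconf_of_def)
  ultimately show ?thesis by (simp add: prod_eq_iff)
qed

lemma mconf_of_eqD: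
  assumes z: "z \<in> dtuples \<Lambda> n" and w: "w \<in> dtuples \<Lambda>' n" and eq: "mconf_of n z = mconf_of n w"
  shows "z ` {..<n} \<subseteq> w ` {..<n}"
proof
  fix p assume "p \<in> z ` {..<n}"
  then obtain i where i: "i < n" "p = z i" by auto
  have "fst (mconf_of n z) = fst (mconf_of n w)" using eq by simp
  then have "fst (z i) \<in> (fst \<circ> w) ` {..<n}" using i by (auto simp: mconf_of_def)
  then obtain j where j: "j < n" "fst (z i) = fst (w j)" by auto
  have "snd (z i) = snd (w j)"
    using mconf_of_apply[OF z i(1)] mconf_of_apply[OF w j(1)] eq j by simp
  then show "p \<in> w ` {..<n}" using i j by (metis imageI lessThan_iff prod_eq_iff)
qed

lemma dtuples_permute:
  assumes z: "z \<in> dtuples \<Lambda> n" and p: "\<pi> permutes {..<n}"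
  shows "z \<circ> \<pi> \<in> dtuples \<Lambda> n" "(z \<circ> \<pi>) ` {..<n} = z ` {..<n}"
proof -
  have im: "\<pi> ` {..<n} = {..<n}" using p by (rule permutes_image)
  have inj: "inj_on (fst \<circ> z) (\<pi> ` {..<n})" using z im by (simp add: dtuples_def)
  have "inj_on ((fst \<circ> z) \<circ> \<pi>) {..<n}"
    by (rule comp_inj_on[OF _ inj]) (use p in \<open>simp add: permutes_inj_on\<close>)
  moreover have "z \<circ> \<pi> \<in> {..<n} \<rightarrow>\<^sub>E \<Lambda> \<times> UNIV"
    using z p im by (auto simp: dtuples_def PiE_def Pi_def extensional_def permutes_def)
  ultimately show "z \<circ> \<pi> \<in> dtuples \<Lambda> n" by (simp add: dtuples_def comp_assoc)
  show "(z \<circ> \<pi>) ` {..<n} = z ` {..<n}" using im by (metis image_comp)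
qed

lemma dtuples_same_image:
  assumes z: "z \<in> dtuples \<Lambda> n" and w: "w \<in> dtuples \<Lambda>' n" and eq: "z ` {..<n} = w ` {..<n}"
  shows "\<exists>\<pi>. \<pi> permutes {..<n} \<and> w = z \<circ> \<pi>"
proof -
  have bz: "bij_betw z {..<n} (z ` {..<n})" and bw: "bij_betw w {..<n} (z ` {..<n})"
    using z w eq by (auto simp: dtuples_def bij_betw_def dest: inj_on_imageI2)
  define \<pi> where "\<pi> i = (if i < n then inv_into {..<n} z (w i) else i)" for i
  have b: "bij_betw (inv_into {..<n} z \<circ> w) {..<n} {..<n}"
    using bw bij_betw_inv_into[OF bz] by (rule bij_betw_trans)
  have "bij_betw \<pi> {..<n} {..<n}"
    using b by (rule iffD1[OF bij_betw_cong, rotated]) (simp add: \<pi>_def)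
  then have p: "\<pi> permutes {..<n}" by (rule bij_imp_permutes) (simp add: \<pi>_def)
  have "w i = (z \<circ> \<pi>) i" for i
  proof (cases "i < n")
    case True
    then have "w i \<in> z ` {..<n}" using eq by simp
    then show ?thesis using True by (simp add: \<pi>_def f_inv_into_f)
  next
    case False
    then have "w i = undefined" "z i = undefined"
      using z w by (auto simp: dtuples_def PiE_def extensional_def)
    then show ?thesis using False by (simp add: \<pi>_def)
  qed
  then show ?thesis using p by blast
qed

lemma tuples_of_orbit:
  assumes "z \<in> tuples_of n \<omega>"
  shows "tuples_of n \<omega> = {z \<circ> \<pi> | \<pi>. \<pi> permutes {..<n}}"
proof (intro equalityI subsetI)
  have z: "z \<in> dtuples UNIV n" "mconf_of n z = \<omega>" using assms by (auto simp: tuples_of_def)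
  fix w assume "w \<in> tuples_of n \<omega>"
  then have w: "w \<in> dtuples UNIV n" "mconf_of n w = \<omega>" by (auto simp: tuples_of_def)
  have "z ` {..<n} = w ` {..<n}"
    using mconf_of_eqD[OF z(1) w(1)] mconf_of_eqD[OF w(1) z(1)] z w by auto
  then show "w \<in> {z \<circ> \<pi> | \<pi>. \<pi> permutes {..<n}}" using dtuples_same_image[OF z(1) w(1)] by blast
next
  have z: "z \<in> dtuples UNIV n" "mconf_of n z = \<omega>" using assms by (auto simp: tuples_of_def)
  fix w assume "w \<in> {z \<circ> \<pi> | \<pi>. \<pi> permutes {..<n}}"
  then obtain \<pi> where p: "\<pi> permutes {..<n}" "w = z \<circ> \<pi>" by blast
  have "mconf_of n w = mconf_of n z"
    using dtuples_permute[OF z(1) p(1)] z(1) p(2) by (intro mconf_of_eqI) auto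
  then show "w \<in> tuples_of n \<omega>"
    using dtuples_permute[OF z(1) p(1)] p(2) z(2) by (simp add: tuples_of_def)
qed

lemma mconf_of_in_mconfs_n:
  fixes z :: "nat \<Rightarrow> 'x::metric_space \<times> 'm"
  assumes "z \<in> dtuples \<Lambda> n"
  shows "mconf_of n z \<in> mconfs_n \<Lambda> n"
proof -
  have "inj_on (fst \<circ> z) {..<n}" using assms by (simp add: dtuples_def)
  then have "card ((fst \<circ> z) ` {..<n}) = n" by (metis card_image card_lessThan)
  moreover have "(fst \<circ> z) ` {..<n} \<subseteq> \<Lambda>"
    using assms by (fastforce simp: dtuples_def PiE_def Pi_def)
  ultimately show ?thesis
    by (simp add: mconf_of_def mconfs_n_def mconfs_def configs_def del: image_comp)
qed

lemma tuples_of_nonempty: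
  assumes "\<omega> \<in> mconfs_n \<Lambda> n"
  shows "tuples_of n \<omega> \<noteq> {}"
proof -
  obtain \<gamma> m where \<omega>: "\<omega> = (\<gamma>, m)" by fastforce
  have m: "finite \<gamma>" "card \<gamma> = n" "m \<in> extensional \<gamma>"
    using assms \<omega> by (auto simp: mconfs_n_def mconfs_def PiE_def)
  then obtain e where e: "bij_betw e {..<n} \<gamma>"
    using bij_betw_from_nat_into_finite[of \<gamma>] by auto
  define z where "z = (\<lambda>i\<in>{..<n}. (e i, m (e i)))"
  have "inj_on (fst \<circ> z) {..<n}"
    using e by (auto simp: z_def inj_on_def bij_betw_def)
  then have z: "z \<in> dtuples UNIV n" by (auto simp: dtuples_def z_def)
  have f: "(fst \<circ> z) ` {..<n} = \<gamma>" using e by (force simp: z_def bij_betw_def)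
  have "snd (mconf_of n z) x = m x" for x
  proof (cases "x \<in> \<gamma>")
    case True
    then obtain i where i: "i < n" "x = e i" using e by (auto simp: bij_betw_def)
    then show ?thesis using mconf_of_apply[OF z i(1)] by (simp add: z_def)
  next
    case False
    then show ?thesis using f m(3) by (simp add: mconf_of_def extensional_def)
  qed
  then have "mconf_of n z = \<omega>" using f \<omega> by (auto simp: prod_eq_iff mconf_of_def)
  then show ?thesis using z by (auto simp: tuples_of_def)
qed

lemma finite_tuples_of: "finite (tuples_of n \<omega>)"
proof (cases "tuples_of n \<omega> = {}")
  case False
  then obtain z where "z \<in> tuples_of n \<omega>" by auto
  then have "tuples_of n \<omega> = (\<lambda>\<pi>. z \<circ> \<pi>) ` {\<pi>. \<pi> permutes {..<n}}"
    using tuples_of_orbit by blast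
  then show ?thesis by (simp add: finite_permutations)
qed simp

lemma tuple_dist_permute:
  assumes "\<pi> permutes {..<n}"
  shows "tuple_dist n (z \<circ> \<pi>) (w \<circ> \<pi>) = tuple_dist n z w"
  using sum.permute[OF assms, of "\<lambda>i. (dist (z i) (w i))\<^sup>2"]
  by (simp add: tuple_dist_def L2_set_def comp_def)

lemma tuple_dist_triangle: "tuple_dist n z u \<le> tuple_dist n z w + tuple_dist n w u"
proof -
  have "tuple_dist n z u \<le> L2_set (\<lambda>i. dist (z i) (w i) + dist (w i) (u i)) {..<n}"
    unfolding tuple_dist_def by (intro L2_set_mono dist_triangle) auto
  also have "\<dots> \<le> tuple_dist n z w + tuple_dist n w u"
    unfolding tuple_dist_def by (rule L2_set_triangle_ineq)
  finally show ?thesis .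
qed

lemma quot_dist_le:
  assumes "z \<in> tuples_of n \<omega>" "w \<in> tuples_of n \<eta>"
  shows "quot_dist n \<omega> \<eta> \<le> tuple_dist n z w"
proof -
  have "Inf {tuple_dist n z w | z w. z \<in> tuples_of n \<omega> \<and> w \<in> tuples_of n \<eta>} \<le> tuple_dist n z w"
    by (rule cInf_lower) (use assms in \<open>auto intro!: bdd_belowI[of _ 0] simp: tuple_dist_def\<close>)
  moreover have "tuples_of n \<omega> \<noteq> {}" "tuples_of n \<eta> \<noteq> {}" using assms by blast+
  ultimately show ?thesis by (simp add: quot_dist_def)
qed

lemma quot_dist_attained:
  assumes "\<omega> \<in> mconfs_n \<Lambda> n" "\<eta> \<in> mconfs_n \<Lambda>' n"
  obtains z w where "z \<in> tuples_of n \<omega>" "w \<in> tuples_of n \<eta>" "quot_dist n \<omega> \<eta> = tuple_dist n z w"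
proof -
  let ?D = "{tuple_dist n z w | z w. z \<in> tuples_of n \<omega> \<and> w \<in> tuples_of n \<eta>}"
  have "?D = (\<lambda>(z, w). tuple_dist n z w) ` (tuples_of n \<omega> \<times> tuples_of n \<eta>)" by auto
  then have "finite ?D" by (simp add: finite_tuples_of)
  moreover have "?D \<noteq> {}" using assms[THEN tuples_of_nonempty] by auto
  ultimately have "Inf ?D \<in> ?D" by (metis (no_types, lifting) Min_in cInf_eq_Min)
  then have "quot_dist n \<omega> \<eta> \<in> ?D"
    using assms[THEN tuples_of_nonempty] by (simp add: quot_dist_def)
  then show ?thesis using that by blast
qed

lemma Metric_space_mconfs_n:
  fixes \<Lambda> :: "'x::metric_space set"
  shows "Metric_space (mconfs_n \<Lambda> n :: ('x, 'm::metric_space) mconf set) (quot_dist n)"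
proof
  fix \<omega> \<eta> :: "('x, 'm) mconf"
  show "0 \<le> quot_dist n \<omega> \<eta>"
  proof (cases "tuples_of n \<omega> = {} \<or> tuples_of n \<eta> = {}")
    case False
    then have "0 \<le> Inf {tuple_dist n z w | z w. z \<in> tuples_of n \<omega> \<and> w \<in> tuples_of n \<eta>}"
      by (intro cInf_greatest) (auto simp: tuple_dist_def)
    then show ?thesis by (simp add: quot_dist_def)
  qed (simp add: quot_dist_def)
  have "tuple_dist n z w = tuple_dist n w z" for z w :: "nat \<Rightarrow> 'x \<times> 'm"
    by (simp add: tuple_dist_def dist_commute)
  then have "{tuple_dist n z w | z w. z \<in> tuples_of n \<omega> \<and> w \<in> tuples_of n \<eta>}
      = {tuple_dist n z w | z w. z \<in> tuples_of n \<eta> \<and> w \<in> tuples_of n \<omega>}"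
    by (intro Collect_cong) metis
  then show "quot_dist n \<omega> \<eta> = quot_dist n \<eta> \<omega>"
    by (simp add: quot_dist_def disj_commute)
next
  fix \<omega> \<eta> :: "('x, 'm) mconf"
  assume m: "\<omega> \<in> mconfs_n \<Lambda> n" "\<eta> \<in> mconfs_n \<Lambda> n"
  show "quot_dist n \<omega> \<eta> = 0 \<longleftrightarrow> \<omega> = \<eta>"
  proof
    assume 0: "quot_dist n \<omega> \<eta> = 0"
    obtain z w where zw: "z \<in> tuples_of n \<omega>" "w \<in> tuples_of n \<eta>" "quot_dist n \<omega> \<eta> = tuple_dist n z w"
      using quot_dist_attained[OF m] .
    then have "\<And>i. i < n \<Longrightarrow> z i = w i"
      using 0 by (auto simp: tuple_dist_def L2_set_eq_0_iff)
    then have "z = w"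
      using zw by (intro PiE_ext[of z "{..<n}"]) (auto simp: tuples_of_def dtuples_def)
    then show "\<omega> = \<eta>" using zw by (auto simp: tuples_of_def)
  next
    assume eq: "\<omega> = \<eta>"
    obtain z where z: "z \<in> tuples_of n \<omega>" using tuples_of_nonempty[OF m(1)] by auto
    obtain z' w' where "z' \<in> tuples_of n \<omega>" "w' \<in> tuples_of n \<eta>"
      "quot_dist n \<omega> \<eta> = tuple_dist n z' w'"
      using quot_dist_attained[OF m] .
    then have "0 \<le> quot_dist n \<omega> \<eta>" by (simp add: tuple_dist_def)
    moreover have "quot_dist n \<omega> \<eta> \<le> 0"
      using quot_dist_le[OF z z] eq by (simp add: tuple_dist_def L2_set_def)
    ultimately show "quot_dist n \<omega> \<eta> = 0" by simp
  qed
next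
  fix \<omega> \<eta> \<xi> :: "('x, 'm) mconf"
  assume m: "\<omega> \<in> mconfs_n \<Lambda> n" "\<eta> \<in> mconfs_n \<Lambda> n" "\<xi> \<in> mconfs_n \<Lambda> n"
  obtain z w where zw: "z \<in> tuples_of n \<omega>" "w \<in> tuples_of n \<eta>" "quot_dist n \<omega> \<eta> = tuple_dist n z w"
    using quot_dist_attained[OF m(1,2)] .
  obtain w' u where wu: "w' \<in> tuples_of n \<eta>" "u \<in> tuples_of n \<xi>" "quot_dist n \<eta> \<xi> = tuple_dist n w' u"
    using quot_dist_attained[OF m(2,3)] .
  obtain \<pi> where p: "\<pi> permutes {..<n}" "w' = w \<circ> \<pi>"
    using tuples_of_orbit[OF zw(2)] wu(1) by blast
  have "z \<circ> \<pi> \<in> tuples_of n \<omega>" using tuples_of_orbit[OF zw(1)] p(1) by blast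
  then have "quot_dist n \<omega> \<xi> \<le> tuple_dist n (z \<circ> \<pi>) u" using wu(2) by (rule quot_dist_le)
  also have "\<dots> \<le> tuple_dist n (z \<circ> \<pi>) w' + tuple_dist n w' u" by (rule tuple_dist_triangle)
  also have "\<dots> = quot_dist n \<omega> \<eta> + quot_dist n \<eta> \<xi>"
    using p by (simp add: tuple_dist_permute zw(3) wu(3))
  finally show "quot_dist n \<omega> \<xi> \<le> quot_dist n \<omega> \<eta> + quot_dist n \<eta> \<xi>" .
qed

lemma topspace_mconf_topology_n [simp]: "topspace (mconf_topology_n \<Lambda> n) = mconfs_n \<Lambda> n"
  by (simp add: mconf_topology_n_def Metric_space.topspace_mtopology[OF Metric_space_mconfs_n])

lemma openin_mconf_topology:
  fixes \<Lambda> :: "'a::metric_space set" and U :: "('a, 'b::metric_space) mconf set"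
  shows "openin (mconf_topology \<Lambda>) U \<longleftrightarrow>
     U \<subseteq> mconfs \<Lambda> \<and> (\<forall>n. openin (mconf_topology_n \<Lambda> n) (U \<inter> mconfs_n \<Lambda> n))"
proof -
  let ?P = "\<lambda>U :: ('a, 'b) mconf set. U \<subseteq> mconfs \<Lambda> \<and> (\<forall>n. openin (mconf_topology_n \<Lambda> n) (U \<inter> mconfs_n \<Lambda> n))"
  have "istopology ?P"
    unfolding istopology_def
  proof (intro conjI allI impI)
    fix S T :: "('a, 'b) mconf set" and n assume "?P S" "?P T"
    then have "openin (mconf_topology_n \<Lambda> n) ((S \<inter> mconfs_n \<Lambda> n) \<inter> (T \<inter> mconfs_n \<Lambda> n))" by blast
    then show "openin (mconf_topology_n \<Lambda> n) (S \<inter> T \<inter> mconfs_n \<Lambda> n)"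
      by (simp add: Int_ac)
  next
    fix \<K> :: "('a, 'b) mconf set set" and n assume "\<forall>K\<in>\<K>. ?P K"
    then have "openin (mconf_topology_n \<Lambda> n) (\<Union>K\<in>\<K>. K \<inter> mconfs_n \<Lambda> n)"
      by (intro openin_Union) auto
    then show "openin (mconf_topology_n \<Lambda> n) (\<Union>\<K> \<inter> mconfs_n \<Lambda> n)" by (simp only: Int_Union2)
  qed blast+
  then show ?thesis unfolding mconf_topology_def by (simp only: topology_inverse')
qed

lemma mconfs_n_disjoint: "n \<noteq> k \<Longrightarrow> mconfs_n \<Lambda> n \<inter> mconfs_n \<Lambda> k = {}"
  by (auto simp: mconfs_n_def)

lemma openin_mconfs_n: "openin (mconf_topology \<Lambda>) (mconfs_n \<Lambda> n)"
proof -
  have "openin (mconf_topology_n \<Lambda> k) (mconfs_n \<Lambda> n \<inter> mconfs_n \<Lambda> k)" for k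
  proof (cases "n = k")
    case True
    then show ?thesis using openin_topspace[of "mconf_topology_n \<Lambda> k"] by simp
  qed (simp add: mconfs_n_disjoint)
  then show ?thesis by (auto simp: openin_mconf_topology mconfs_n_def)
qed

lemma mconfs_Union:
  assumes "\<Lambda> \<in> Oc"
  shows "mconfs \<Lambda> = (\<Union>n. mconfs_n \<Lambda> n)"
proof -
  have "finite \<gamma>" if "\<gamma> \<in> configs \<Lambda>" for \<gamma>
  proof -
    have "finite (\<gamma> \<inter> closure \<Lambda>)" using that assms by (simp add: configs_def Oc_def)
    moreover have "\<gamma> \<inter> closure \<Lambda> = \<gamma>" using that closure_subset by (auto simp: configs_def)
    ultimately show ?thesis by simp
  qed
  then show ?thesis by (auto simp: mconfs_n_def mconfs_def)
qed

lemma topspace_mconf_topology [simp]: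
  assumes "\<Lambda> \<in> Oc"
  shows "topspace (mconf_topology \<Lambda>) = mconfs \<Lambda>"
proof (rule equalityI)
  show "topspace (mconf_topology \<Lambda>) \<subseteq> mconfs \<Lambda>"
    using openin_topspace[of "mconf_topology \<Lambda>"] unfolding openin_mconf_topology by (rule conjunct1)
  show "mconfs \<Lambda> \<subseteq> topspace (mconf_topology \<Lambda>)"
    unfolding mconfs_Union[OF assms] by (intro UN_least openin_subset openin_mconfs_n)
qed

lemma mrestrict_mconfs: "\<omega> \<in> mconfs \<Lambda>' \<Longrightarrow> mrestrict \<Lambda> \<omega> \<in> mconfs \<Lambda>"
proof -
  assume "\<omega> \<in> mconfs \<Lambda>'"
  then have K: "finite (fst \<omega> \<inter> K)" if "compact K" for K
    using that by (auto simp: mconfs_def configs_def)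
  have "finite (fst \<omega> \<inter> \<Lambda> \<inter> K)" if "compact K" for K
    by (rule finite_subset[OF _ K[OF that]]) blast
  then show ?thesis by (simp add: mconfs_def configs_def mrestrict_def)
qed

lemma one_point_sets_open:
  fixes \<Lambda> A :: "'x::metric_space set"
  assumes L: "\<Lambda> \<in> Oc" and A: "A \<subseteq> \<Lambda>"
  shows "openin (topology_generated_by cylinders)
           {\<omega> \<in> (mconfs UNIV :: ('x, 'm::metric_space) mconf set). \<exists>x\<in>A. fst \<omega> \<inter> \<Lambda> = {x}}"
proof -
  define N :: "'x set \<Rightarrow> nat \<Rightarrow> ('x, 'm) mconf set"
    where "N \<Lambda> n = mrestrict \<Lambda> -` mconfs_n \<Lambda> n \<inter> mconfs UNIV" for \<Lambda> n
  have N: "openin (topology_generated_by cylinders) (N \<Lambda> n)" if "\<Lambda> \<in> Oc" for \<Lambda> n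
    using that openin_mconfs_n by (intro topology_generated_by_Basis) (auto simp: cylinders_def N_def)
  have memN: "\<omega> \<in> N \<Lambda> n \<longleftrightarrow> \<omega> \<in> mconfs UNIV \<and> finite (fst \<omega> \<inter> \<Lambda>) \<and> card (fst \<omega> \<inter> \<Lambda>) = n"
    for \<omega> \<Lambda> n
    using mrestrict_mconfs[of \<omega> UNIV \<Lambda>] by (auto simp: N_def mconfs_n_def mrestrict_def)
  have minus: "\<Lambda> - {x} \<in> Oc" for x
  proof -
    have "closed (closure \<Lambda> \<inter> closure (\<Lambda> - {x}))" by auto
    moreover have "closure (\<Lambda> - {x}) \<subseteq> closure \<Lambda>" by (simp add: closure_mono)
    ultimately have "compact (closure (\<Lambda> - {x}))"
      using L by (metis Oc_def closed_closure compact_Int_closed inf.absorb2 mem_Collect_eq)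
    then show ?thesis using L by (auto simp: Oc_def intro: open_Diff)
  qed
  let ?E = "{\<omega> \<in> (mconfs UNIV :: ('x, 'm) mconf set). \<exists>x\<in>A. fst \<omega> \<inter> \<Lambda> = {x}}"
  have "?E = (\<Union>x\<in>A. N \<Lambda> 1 \<inter> N (\<Lambda> - {x}) 0)"
  proof (intro equalityI subsetI)
    fix \<omega> assume "\<omega> \<in> ?E"
    then obtain x where x: "\<omega> \<in> mconfs UNIV" "x \<in> A" "fst \<omega> \<inter> \<Lambda> = {x}" by auto
    then have "fst \<omega> \<inter> (\<Lambda> - {x}) = {}" by auto
    then have "\<omega> \<in> N \<Lambda> 1 \<inter> N (\<Lambda> - {x}) 0" using x by (simp add: memN)
    then show "\<omega> \<in> (\<Union>x\<in>A. N \<Lambda> 1 \<inter> N (\<Lambda> - {x}) 0)" using x(2) by blast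
  next
    fix \<omega> assume "\<omega> \<in> (\<Union>x\<in>A. N \<Lambda> 1 \<inter> N (\<Lambda> - {x}) 0)"
    then obtain x where x: "\<omega> \<in> mconfs UNIV" "x \<in> A" "card (fst \<omega> \<inter> \<Lambda>) = 1"
      "fst \<omega> \<inter> (\<Lambda> - {x}) = {}" by (auto simp: memN)
    then obtain y where "fst \<omega> \<inter> \<Lambda> = {y}" by (auto simp: card_1_singleton_iff)
    then have "fst \<omega> \<inter> \<Lambda> = {x}" using x(4) A x(2) by auto
    then show "\<omega> \<in> ?E" using x by auto
  qed
  then show ?thesis using N[OF L] N[OF minus] by (auto intro!: openin_Union)
qed

end

theory Submission
  imports Defs "HOL-Probability.Infinite_Product_Measure"
begin

text \<open>A marked configuration is a simple point set in \<open>X \<times> M\<close>, so (as in Renyi's theorem) its law is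
  determined by the probabilities of the void events ``no point in \<open>B\<close>'' with \<open>B\<close> open: these
  events are stable under intersection and, \<open>X \<times> M\<close> being second countable, generate the Borel
  sets. Under \<open>marked_poisson_on \<sigma> \<tau> \<Lambda>\<close> a void event has probability \<open>exp (- (\<sigma> \<otimes> \<tau>) B)\<close> for
  \<open>B \<subseteq> \<Lambda> \<times> M\<close>, which does not depend on \<open>\<Lambda>\<close>; this gives consistency and uniqueness. For
  existence, partition \<open>X\<close> into countably many relatively compact Borel cells, put independent
  Poisson configurations on them and superpose: void probabilities multiply over the cells.\<close>

section \<open>Void events generate the Borel sets\<close>

text \<open>Configurations are unordered while the topology lives on classes of tuples; void events
  need no choice of enumeration. That they suffice rests on one observation: a configuration with
  exactly n points that meets n disjoint small open sets has one point in each, and any two such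
  configurations are close in \<open>quot_dist\<close>. The exponential comes from a series: the
  n-tuples avoiding \<open>B\<close> have weight a^n / n!, where a is the mass of the strip over
  \<Lambda> outside \<open>B\<close>. Tuples with coinciding positions are excluded from this count,
  which is harmless because points are null for \<sigma>. The cells of the partition are not open,
  whereas the local measures live over open sets; hence the points are drawn over the open members
  of a cover and trimmed to the cells, and void events of differences of open sets have to be
  measurable too. A test set over a relatively compact region meets finitely many cells only, so its
  void probability is a finite product.\<close>

definition pts :: "('x, 'm) mconf \<Rightarrow> ('x \<times> 'm) set"
  where "pts \<omega> = (\<lambda>x. (x, snd \<omega> x)) ` fst \<omega>"

text \<open>\<open>B\<close> is not confined to the strip over \<open>S\<close>; only its part in
  \<open>S \<times> UNIV\<close> matters. With \<open>S = UNIV\<close> the same formula gives the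
  global events.\<close>

definition voids :: "'x::topological_space set \<Rightarrow> ('x \<times> 'm) set \<Rightarrow> ('x, 'm) mconf set"
  where "voids S B = {\<omega> \<in> mconfs S. pts \<omega> \<inter> B = {}}"

lemma card_pts: "card (pts \<omega>) = card (fst \<omega>)"
  by (simp add: pts_def card_image inj_on_def)

lemma finite_pts [simp]: "finite (pts \<omega>) \<longleftrightarrow> finite (fst \<omega>)"
  by (simp add: pts_def finite_image_iff inj_on_def)

lemma inj_on_fst_pts: "inj_on fst (pts \<omega>)"
  by (auto simp: pts_def inj_on_def)

lemma pts_mrestrict: "pts (mrestrict S \<omega>) = pts \<omega> \<inter> S \<times> UNIV"
  by (auto simp: pts_def mrestrict_def)

lemma pts_mconf_of:
  assumes "z \<in> dtuples S n"
  shows "pts (mconf_of n z) = z ` {..<n}"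
proof -
  have "fst (mconf_of n z) = (\<lambda>i. fst (z i)) ` {..<n}"
    by (simp add: mconf_of_def comp_def)
  then show ?thesis
    unfolding pts_def image_image
    by (simp only: image_image) (auto simp: mconf_of_apply[OF assms] intro!: image_eqI)
qed

lemma finite_mconfs:
  assumes "S \<in> Oc" "\<omega> \<in> mconfs S"
  shows "finite (fst \<omega>)"
  using assms mconfs_Union[OF assms(1)] by (auto simp: mconfs_n_def)

lemma mconfs_n_subset: "mconfs_n S n \<subseteq> mconfs S"
  by (auto simp: mconfs_n_def)

lemma pts_subset: "\<omega> \<in> mconfs S \<Longrightarrow> pts \<omega> \<subseteq> S \<times> UNIV"
  by (auto simp: mconfs_def configs_def pts_def)

lemma voids_Int: "voids S B \<inter> voids S C = voids S (B \<union> C)"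
  by (auto simp: voids_def)

lemma voids_empty: "voids S {} = mconfs S"
  by (auto simp: voids_def)

lemma voids_subset: "voids S B \<subseteq> mconfs S"
  by (auto simp: voids_def)

text \<open>Restriction cuts the point set by a strip, and cutting the test set has the same effect.
  So void events pull back to void events, and comparing image measures reduces to comparing void
  probabilities.\<close>

lemma mrestrict_vimage_voids:
  "mrestrict S -` voids S B \<inter> mconfs T = voids T (B \<inter> S \<times> UNIV)"
  by (auto simp: voids_def pts_mrestrict mrestrict_mconfs)

section \<open>Tuples as enumerations of the point set\<close>

lemma tuples_of_pts:
  assumes z: "z \<in> tuples_of n \<omega>"
  shows "z ` {..<n} = pts \<omega>" "inj_on z {..<n}"
  using z pts_mconf_of[of z UNIV n]
  by (auto simp: tuples_of_def dtuples_def dest: inj_on_imageI2)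

text \<open>An injective tuple of \<open>n\<close> points inside a set of size \<open>n\<close>
  exhausts it, so inclusion in \<open>pts \<omega>\<close> is enough; positions are distinct because
  \<open>fst\<close> is injective on \<open>pts \<omega>\<close>.\<close>

lemma tuples_ofI:
  fixes \<omega> :: "('x::metric_space, 'm) mconf"
  assumes "\<omega> \<in> mconfs_n S n" "w \<in> extensional {..<n}" "inj_on w {..<n}" "w ` {..<n} \<subseteq> pts \<omega>"
  shows "w \<in> tuples_of n \<omega>"
proof -
  have fin: "finite (pts \<omega>)" "card (pts \<omega>) = n"
    using assms(1) by (auto simp: mconfs_n_def card_pts)
  have im: "w ` {..<n} = pts \<omega>"
    using assms fin by (intro card_subset_eq) (auto simp: card_image)
  have w: "w \<in> dtuples UNIV n"
    using assms im inj_on_fst_pts[of \<omega>] by (simp add: dtuples_def PiE_def comp_inj_on)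
  obtain z where z: "z \<in> tuples_of n \<omega>" using tuples_of_nonempty[OF assms(1)] by auto
  have "mconf_of n w = mconf_of n z"
    using z w im tuples_of_pts(1)[OF z] by (intro mconf_of_eqI) (auto simp: tuples_of_def)
  then show ?thesis using z w by (simp add: tuples_of_def)
qed

section \<open>Hitting events of disjoint basic open sets\<close>

lemma disjoint_neighbourhoods:
  fixes P :: "'a::metric_space set"
  assumes "topological_basis \<B>" "finite P" "e > 0"
  obtains b where "inj_on b P" "b ` P \<subseteq> \<B>" "disjoint (b ` P)" "\<And>p. p \<in> P \<Longrightarrow> p \<in> b p \<and> b p \<subseteq> ball p e"
proof -
  \<comment> \<open>The minimum of \<open>D\<close> is at most half of every distance between
    distinct points, so balls of this radius are disjoint. The entry \<open>e\<close> caps the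
    radius and keeps \<open>D\<close> nonempty.\<close>
  define D where "D = insert e ((\<lambda>(p, q). dist p q / 2) ` {(p, q) \<in> P \<times> P. p \<noteq> q})"
  have "finite {(p, q) \<in> P \<times> P. p \<noteq> q}"
    by (rule finite_subset[of _ "P \<times> P"]) (use assms in auto)
  then have D: "finite D" "D \<noteq> {}" by (auto simp: D_def)
  define d where "d = Min D"
  have d: "d > 0" "d \<le> e" using D assms(3) by (auto simp: d_def D_def)
  have sep: "2 * d \<le> dist p q" if "p \<in> P" "q \<in> P" "p \<noteq> q" for p q
  proof -
    have "d \<le> dist p q / 2" unfolding d_def by (rule Min_le) (use D that in \<open>auto simp: D_def\<close>)
    then show ?thesis by simp
  qed
  have "\<exists>B\<in>\<B>. p \<in> B \<and> B \<subseteq> ball p d" for p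
    using topological_basisE[OF assms(1), of "ball p d" p] d(1) by (metis centre_in_ball open_ball)
  then obtain b where b: "\<And>p. b p \<in> \<B>" "\<And>p. p \<in> b p" "\<And>p. b p \<subseteq> ball p d" by metis
  have disj: "b p \<inter> b q = {}" if "p \<in> P" "q \<in> P" "p \<noteq> q" for p q
  proof (rule ccontr)
    assume "b p \<inter> b q \<noteq> {}"
    then obtain x where "dist p x < d" "dist q x < d" using b(3) by (auto simp: subset_iff)
    then show False using sep[OF that] dist_triangle2[of p q x] by linarith
  qed
  show ?thesis
  proof (rule that[of b])
    show "inj_on b P" using disj b(2) by (fastforce simp: inj_on_def)
    show "disjoint (b ` P)" using disj by (auto simp: disjoint_def)
    show "p \<in> b p \<and> b p \<subseteq> ball p e" for p using b(2,3)[of p] d(2) by auto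
  qed (use b in auto)
qed

definition hits :: "'x::topological_space set \<Rightarrow> ('x \<times> 'm) set set \<Rightarrow> ('x, 'm) mconf set"
  where "hits S F = {\<omega> \<in> mconfs S. \<forall>B\<in>F. pts \<omega> \<inter> B \<noteq> {}}"

lemma hits_eq: "hits S F = mconfs S \<inter> (\<Inter>B\<in>F. mconfs S - voids S B)"
  by (auto simp: hits_def voids_def)

text \<open>The fixed countable base leaves only countably many finite families, so unions over them
  stay measurable; disjointness makes every member that is hit require a point of its own.\<close>

definition basic_families :: "'a::second_countable_topology set set set"
  where "basic_families = {F. finite F \<and> F \<subseteq> (SOME \<B>. countable \<B> \<and> topological_basis \<B>) \<and> disjoint F}"

lemma some_basis:
  "countable (SOME \<B>::'a::second_countable_topology set set. countable \<B> \<and> topological_basis \<B>)"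
  "topological_basis (SOME \<B>::'a::second_countable_topology set set. countable \<B> \<and> topological_basis \<B>)"
  using someI_ex[OF ex_countable_basis[where 'a='a]] by auto

lemma countable_basic_families: "countable basic_families"
  unfolding basic_families_def
  by (rule countable_subset[OF _ countable_Collect_finite_subset[OF some_basis(1)]]) auto

lemma basic_familiesD:
  assumes "F \<in> basic_families"
  shows "finite F" "disjoint F" "\<And>B. B \<in> F \<Longrightarrow> open B"
  using assms topological_basis_open[OF some_basis(2)] by (auto simp: basic_families_def)

lemma basic_family_near:
  fixes P :: "'a::{metric_space, second_countable_topology} set"
  assumes "finite P" "e > 0"
  obtains F b where "F \<in> basic_families" "bij_betw b P F"
    "\<And>p. p \<in> P \<Longrightarrow> p \<in> b p \<and> b p \<subseteq> ball p e"
proof -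
  obtain b where "inj_on b P" "b ` P \<subseteq> (SOME \<B>. countable \<B> \<and> topological_basis \<B>)"
    "disjoint (b ` P)" "\<And>p. p \<in> P \<Longrightarrow> p \<in> b p \<and> b p \<subseteq> ball p e"
    using disjoint_neighbourhoods[OF some_basis(2) assms] by metis
  then show ?thesis using assms(1) by (intro that[of "b ` P" b]) (auto simp: basic_families_def bij_betw_def)
qed

lemma in_hitsI:
  assumes "\<omega> \<in> mconfs S" "P \<subseteq> pts \<omega>" "bij_betw b P F" "\<And>p. p \<in> P \<Longrightarrow> p \<in> b p"
  shows "\<omega> \<in> hits S F"
proof -
  have "pts \<omega> \<inter> B \<noteq> {}" if B: "B \<in> F" for B
  proof -
    obtain p where "p \<in> P" "B = b p" using B assms(3) unfolding bij_betw_def by blast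
    then show ?thesis using assms(2,4) by blast
  qed
  then show ?thesis using assms(1) by (simp add: hits_def)
qed

text \<open>Any \<open>n\<close> points of a configuration can be separated by disjoint basic sets,
  and conversely \<open>n\<close> disjoint sets that are hit need \<open>n\<close> different points.
  \<open>Oc\<close> ensures finiteness, without which \<open>card\<close> would be 0.\<close>

lemma many_points_eq:
  fixes S :: "'x::{metric_space, second_countable_topology} set"
  assumes "S \<in> Oc"
  shows "{\<omega> \<in> (mconfs S :: ('x, 'm::{metric_space, second_countable_topology}) mconf set). n \<le> card (fst \<omega>)}
    = (\<Union>F\<in>{F\<in>basic_families. card F = n}. hits S F)" (is "?L = ?R")
proof (intro equalityI subsetI)
  fix \<omega> assume "\<omega> \<in> ?L"
  then have w: "\<omega> \<in> mconfs S" "n \<le> card (pts \<omega>)" by (auto simp: card_pts)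
  obtain P where P: "P \<subseteq> pts \<omega>" "card P = n" "finite P"
    by (rule obtain_subset_with_card_n[OF w(2)])
  obtain F b where F: "F \<in> basic_families" "bij_betw b P F"
    "\<And>p. p \<in> P \<Longrightarrow> p \<in> b p \<and> b p \<subseteq> ball p 1"
    using basic_family_near[OF P(3), of 1] by auto
  have "card F = n" using bij_betw_same_card[OF F(2)] P by simp
  moreover have "\<omega> \<in> hits S F" using F w(1) P by (intro in_hitsI[of _ S P b]) auto
  ultimately show "\<omega> \<in> ?R" using F by auto
next
  fix \<omega> assume "\<omega> \<in> ?R"
  then obtain F where F: "F \<in> basic_families" "card F = n" "\<omega> \<in> hits S F" by auto
  have "\<exists>q. q \<in> pts \<omega> \<inter> B" if "B \<in> F" for B using F(3) that by (auto simp: hits_def)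
  then obtain c where c: "\<And>B. B \<in> F \<Longrightarrow> c B \<in> pts \<omega> \<inter> B" by metis
  have "inj_on c F"
  proof (rule inj_onI)
    fix B C assume BC: "B \<in> F" "C \<in> F" "c B = c C"
    then have "B \<inter> C \<noteq> {}" using c[of B] c[of C] by auto
    then show "B = C" using basic_familiesD(2)[OF F(1)] BC by (auto simp: disjoint_def)
  qed
  moreover have "c ` F \<subseteq> pts \<omega>" using c by auto
  moreover have "\<omega> \<in> mconfs S" using F by (simp add: hits_def)
  moreover have "finite (pts \<omega>)" using finite_mconfs[OF assms \<open>\<omega> \<in> mconfs S\<close>] by simp
  ultimately show "\<omega> \<in> ?L" using F(2) card_inj_on_le[of c F "pts \<omega>"] by (auto simp: card_pts)
qed

text \<open>Around each configuration of \<open>W\<close>, small disjoint neighbourhoods of its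
  points give a hitting event that, among \<open>n\<close>-point configurations, stays within a
  given \<open>quot_dist\<close> ball. The union is countable.\<close>

lemma open_n_eq:
  fixes S :: "'x::{metric_space, second_countable_topology} set"
    and W :: "('x, 'm::{metric_space, second_countable_topology}) mconf set"
  assumes W: "openin (mconf_topology_n S n) W"
  shows "W = (\<Union>F\<in>{F\<in>basic_families. hits S F \<inter> mconfs_n S n \<subseteq> W}. hits S F \<inter> mconfs_n S n)"
    (is "W = ?R")
proof (intro equalityI subsetI)
  fix \<omega> assume \<omega>: "\<omega> \<in> W"
  interpret Metric_space "mconfs_n S n :: ('x, 'm) mconf set" "quot_dist n" by (rule Metric_space_mconfs_n)
  obtain e where e: "e > 0" "mball \<omega> e \<subseteq> W"
    using W \<omega> unfolding mconf_topology_n_def openin_mtopology by blast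
  have wn: "\<omega> \<in> mconfs_n S n" using W \<omega> openin_subset by fastforce
  \<comment> \<open>The sum of \<open>n\<close> coordinate distances, each at most \<open>d\<close>,
    must stay below \<open>e\<close>; the \<open>+ 1\<close> makes this strict and covers
    \<open>n = 0\<close>.\<close>
  define d where "d = e / (n + 1)"
  have d: "d > 0" "n * d < e" using e by (auto simp: d_def field_simps)
  have fin: "finite (pts \<omega>)" using wn by (simp add: mconfs_n_def)
  obtain F b where F: "F \<in> basic_families" "bij_betw b (pts \<omega>) F"
    "\<And>p. p \<in> pts \<omega> \<Longrightarrow> p \<in> b p \<and> b p \<subseteq> ball p d"
    using basic_family_near[OF fin d(1)] by metis
  obtain z where z: "z \<in> tuples_of n \<omega>" using tuples_of_nonempty[OF wn] by auto
  note zp = tuples_of_pts[OF z]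
  have "hits S F \<inter> mconfs_n S n \<subseteq> W"
  proof
    fix \<eta> assume \<eta>: "\<eta> \<in> hits S F \<inter> mconfs_n S n"
    have "\<exists>q. q \<in> pts \<eta> \<inter> b p" if "p \<in> pts \<omega>" for p
    proof -
      have "b p \<in> F" using F(2) that by (auto simp: bij_betw_def)
      then show ?thesis using \<eta> by (auto simp: hits_def)
    qed
    then obtain c where c: "\<And>p. p \<in> pts \<omega> \<Longrightarrow> c p \<in> pts \<eta> \<inter> b p" by metis
    define w where "w = (\<lambda>i\<in>{..<n}. c (z i))"
    have zi: "z i \<in> pts \<omega>" if "i < n" for i using zp that by auto
    \<comment> \<open>The chosen points lie in disjoint sets, so they are distinct; being
      \<open>n\<close> in number, they are all the points of \<eta>, and \<open>w\<close> enumerates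
      \<eta> in the order matching \<open>z\<close>.\<close>
    have "inj_on c (pts \<omega>)"
    proof (rule inj_onI)
      fix p q assume pq: "p \<in> pts \<omega>" "q \<in> pts \<omega>" "c p = c q"
      then have "b p \<inter> b q \<noteq> {}" using c[of p] c[of q] by auto
      moreover have "b p \<in> F" "b q \<in> F" using F(2) pq by (auto simp: bij_betw_def)
      ultimately have "b p = b q" using basic_familiesD(2)[OF F(1)] by (auto simp: disjoint_def)
      then show "p = q" using F(2) pq by (auto simp: bij_betw_def inj_on_def)
    qed
    then have "inj_on w {..<n}"
      using zi zp(2) by (auto simp: w_def inj_on_def)
    moreover have "w ` {..<n} \<subseteq> pts \<eta>"
    proof (rule image_subsetI)
      fix i assume "i \<in> {..<n}"
      then show "w i \<in> pts \<eta>" using c[OF zi[of i]] by (simp add: w_def)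
    qed
    ultimately have w: "w \<in> tuples_of n \<eta>"
      using \<eta> by (intro tuples_ofI[of _ S]) (auto simp: w_def)
    have "dist (z i) (w i) \<le> d" if "i < n" for i
      using c[OF zi[OF that]] F(3)[OF zi[OF that]] that
        mem_ball[of "w i" "z i" d] by (auto simp: w_def intro: less_imp_le)
    then have "(\<Sum>i<n. dist (z i) (w i)) \<le> n * d"
      using sum_bounded_above[of "{..<n}" "\<lambda>i. dist (z i) (w i)" d] by simp
    moreover have "tuple_dist n z w \<le> (\<Sum>i<n. dist (z i) (w i))"
      unfolding tuple_dist_def by (rule L2_set_le_sum) auto
    ultimately have "quot_dist n \<omega> \<eta> < e" using quot_dist_le[OF z w] d(2) by linarith
    then have "\<eta> \<in> mball \<omega> e" unfolding in_mball using \<eta> wn by blast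
    then show "\<eta> \<in> W" using e(2) by blast
  qed
  moreover have "\<omega> \<in> hits S F"
    using F subsetD[OF mconfs_n_subset wn] by (intro in_hitsI[of _ S "pts \<omega>" b]) auto
  ultimately show "\<omega> \<in> ?R" using F(1) wn by auto
qed auto

section \<open>Borel sets over a relatively compact region\<close>

abbreviation open_voids :: "'x::topological_space set \<Rightarrow> ('x, 'm::topological_space) mconf set set"
  where "open_voids S \<equiv> {voids S B | B. open B}"

lemma hits_in_sigma_voids:
  assumes "F \<in> basic_families"
  shows "hits S F \<in> sigma_sets (mconfs S) (open_voids S)"
proof -
  interpret sigma_algebra "mconfs S" "sigma_sets (mconfs S) (open_voids S)"
    by (rule sigma_algebra_sigma_sets) (use voids_subset in auto)
  have "voids S B \<in> sigma_sets (mconfs S) (open_voids S)" if "B \<in> F" for B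
    using basic_familiesD(3)[OF assms that] by (intro sigma_sets.Basic) auto
  then have "mconfs S - voids S B \<in> sigma_sets (mconfs S) (open_voids S)" if "B \<in> F" for B
    using that by (intro compl_sets) auto
  \<comment> \<open>The empty family is treated apart: the intersection over it is
    \<open>UNIV\<close>, not an event in \<open>mconfs S\<close>.\<close>
  then show ?thesis
    unfolding hits_eq using basic_familiesD(1)[OF assms]
    by (cases "F = {}") (simp_all add: sigma_sets_top Int finite_INT del: INT_simps)
qed

text \<open>Exactly \<open>n\<close> points means at least \<open>n\<close> but not at least
  \<open>n + 1\<close>, and both of these are countable unions of hitting events.\<close>

lemma mconfs_n_in_sigma_voids:
  fixes S :: "'x::{metric_space, second_countable_topology} set"
  assumes "S \<in> Oc"
  shows "(mconfs_n S n :: ('x, 'm::{metric_space, second_countable_topology}) mconf set)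
    \<in> sigma_sets (mconfs S) (open_voids S)"
proof -
  interpret sigma_algebra "mconfs S" "sigma_sets (mconfs S) (open_voids S) :: ('x, 'm) mconf set set"
    by (rule sigma_algebra_sigma_sets) (use voids_subset in auto)
  have "{\<omega> \<in> (mconfs S :: ('x, 'm) mconf set). k \<le> card (fst \<omega>)} \<in> sigma_sets (mconfs S) (open_voids S)" for k
    unfolding many_points_eq[OF assms]
    by (intro countable_UN' countable_subset[OF _ countable_basic_families] image_subsetI hits_in_sigma_voids) auto
  from Diff[OF this[of n] this[of "Suc n"]]
  show ?thesis
    by (rule back_subst[where P="\<lambda>X. X \<in> _"]) (use finite_mconfs[OF assms] in \<open>force simp: mconfs_n_def\<close>)
qed

lemma sets_borel_of: "sets (borel_of T) = sigma_sets (topspace T) {U. openin T U}"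
  unfolding borel_of_def by (rule sets_measure_of) (use openin_subset in auto)

lemma space_borel_of [simp]: "space (borel_of T) = topspace T"
  unfolding borel_of_def by (rule space_measure_of) (use openin_subset in auto)

lemma openin_sets_borel_of: "openin T U \<Longrightarrow> U \<in> sets (borel_of T)"
  by (simp add: sets_borel_of sigma_sets.Basic)

text \<open>Points may enter the open set \<open>U\<close> under small perturbations but cannot leave it, so
  only counts bounded from below give open events.\<close>

lemma openin_count:
  fixes U :: "('x::metric_space \<times> 'm::metric_space) set"
  assumes "open U"
  shows "openin (mconf_topology S) {\<omega> \<in> mconfs S. finite (fst \<omega>) \<and> k \<le> card (pts \<omega> \<inter> U)}"
  unfolding openin_mconf_topology
proof (intro conjI allI)
  fix n
  interpret Metric_space "mconfs_n S n :: ('x, 'm) mconf set" "quot_dist n" by (rule Metric_space_mconfs_n)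
  let ?V = "{\<omega> \<in> mconfs S. finite (fst \<omega>) \<and> k \<le> card (pts \<omega> \<inter> U)} \<inter> mconfs_n S n"
  have "\<exists>e>0. mball \<omega> e \<subseteq> ?V" if "\<omega> \<in> ?V" for \<omega>
  proof -
    have wn: "\<omega> \<in> mconfs_n S n" "k \<le> card (pts \<omega> \<inter> U)" using that by auto
    have "\<exists>e>0. ball p e \<subseteq> U" if "p \<in> U" for p using that assms by (auto simp: open_contains_ball)
    then obtain r where r: "\<And>p. p \<in> U \<Longrightarrow> r p > 0 \<and> ball p (r p) \<subseteq> U" by metis
    \<comment> \<open>The entry 1 keeps the minimum defined when no point of \<omega> lies in
      \<open>U\<close>. Every point in \<open>U\<close> can move by less than \<open>e\<close>
      without leaving \<open>U\<close>.\<close>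
    define e where "e = Min (insert 1 (r ` (pts \<omega> \<inter> U)))"
    have fin: "finite (insert 1 (r ` (pts \<omega> \<inter> U)))" using wn(1) by (auto simp: mconfs_n_def)
    have e: "e > 0" unfolding e_def using fin r by (subst Min_gr_iff) auto
    have er: "e \<le> r p" if "p \<in> pts \<omega> \<inter> U" for p
      unfolding e_def by (rule Min_le) (use fin that in auto)
    have "\<eta> \<in> ?V" if \<eta>: "\<eta> \<in> mball \<omega> e" for \<eta>
    proof -
      have \<eta>: "\<eta> \<in> mconfs_n S n" "quot_dist n \<omega> \<eta> < e" using \<eta> by auto
      obtain z w where zw: "z \<in> tuples_of n \<omega>" "w \<in> tuples_of n \<eta>" "quot_dist n \<omega> \<eta> = tuple_dist n z w"
        using quot_dist_attained[OF wn(1) \<eta>(1)] .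
      note zp = tuples_of_pts[OF zw(1)] and wp = tuples_of_pts[OF zw(2)]
      have "w i \<in> U" if "i < n" "z i \<in> U" for i
      proof -
        have "dist (z i) (w i) \<le> tuple_dist n z w"
          unfolding tuple_dist_def by (rule member_le_L2_set) (use that in auto)
        also have "\<dots> < r (z i)" using \<eta>(2) zw(3) er[of "z i"] zp that by fastforce
        finally show ?thesis using r[OF that(2)] by auto
      qed
      then have "card {i \<in> {..<n}. z i \<in> U} \<le> card {i \<in> {..<n}. w i \<in> U}"
        by (intro card_mono) auto
      moreover have c: "card {i \<in> {..<n}. v i \<in> U} = card (pts \<xi> \<inter> U)"
        if "v ` {..<n} = pts \<xi>" "inj_on v {..<n}" for v \<xi>
      proof -
        have "bij_betw v {i \<in> {..<n}. v i \<in> U} (pts \<xi> \<inter> U)"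
        proof (rule bij_betw_subset[of v "{..<n}" "pts \<xi>"])
          show "bij_betw v {..<n} (pts \<xi>)" using that by (simp add: bij_betw_def)
          show "v ` {i \<in> {..<n}. v i \<in> U} = pts \<xi> \<inter> U" unfolding that(1)[symmetric] by blast
        qed blast
        then show ?thesis by (rule bij_betw_same_card)
      qed
      ultimately have "k \<le> card (pts \<eta> \<inter> U)"
        unfolding c[OF zp] c[OF wp] using wn(2) by linarith
      then show ?thesis using \<eta> by (auto simp: mconfs_n_def)
    qed
    then show ?thesis using e by blast
  qed
  then show "openin (mconf_topology_n S n) ?V"
    unfolding mconf_topology_n_def openin_mtopology by blast
qed auto

text \<open>The cells of the partition used for existence are differences of open sets, hence this
  form.\<close>

lemma voids_Diff_in_sets:
  fixes U V :: "('x::metric_space \<times> 'm::metric_space) set"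
  assumes S: "S \<in> Oc" and "open U" "open V"
  shows "voids S (U - V) \<in> sets (borel_of (mconf_topology S))"
proof -
  let ?C = "\<lambda>W k. {\<omega> \<in> (mconfs S :: ('x, 'm) mconf set). finite (fst \<omega>) \<and> k \<le> card (pts \<omega> \<inter> W)}"
  have fin: "finite (pts \<omega>)" if "\<omega> \<in> mconfs S" for \<omega> :: "('x, 'm) mconf"
    using finite_mconfs[OF S that] by simp
  \<comment> \<open>No point lies in \<open>U - V\<close> exactly when \<open>U\<close> and
    \<open>U \<inter> V\<close> hold equally many points. Inequality of the two counts is witnessed
    by a threshold \<open>k\<close> that only \<open>U\<close> reaches, which uses nothing but lower
    bounds on counts.\<close>
  have "voids S (U - V) = mconfs S - (\<Union>k. ?C U k - ?C (U \<inter> V) k)"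
  proof (intro equalityI subsetI)
    fix \<omega> assume "\<omega> \<in> voids S (U - V)"
    then have "pts \<omega> \<inter> U = pts \<omega> \<inter> (U \<inter> V)" "\<omega> \<in> mconfs S" by (auto simp: voids_def)
    then show "\<omega> \<in> mconfs S - (\<Union>k. ?C U k - ?C (U \<inter> V) k)" by auto
  next
    fix \<omega> assume w: "\<omega> \<in> mconfs S - (\<Union>k. ?C U k - ?C (U \<inter> V) k)"
    then have "card (pts \<omega> \<inter> U) \<le> card (pts \<omega> \<inter> (U \<inter> V))" using fin[of \<omega>] by auto
    then have "pts \<omega> \<inter> (U \<inter> V) = pts \<omega> \<inter> U" using fin[of \<omega>] w by (intro card_seteq) auto
    then show "\<omega> \<in> voids S (U - V)" using w by (auto simp: voids_def)
  qed
  moreover have C: "?C W k \<in> sets (borel_of (mconf_topology S))" if "open W" for W k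
    using openin_count[OF that] by (rule openin_sets_borel_of)
  moreover have "(\<Union>k. ?C U k - ?C (U \<inter> V) k) \<in> sets (borel_of (mconf_topology S))"
    by (intro sets.countable_UN image_subsetI sets.Diff C open_Int assms(2,3))
  moreover have "mconfs S \<in> sets (borel_of (mconf_topology S) :: ('x, 'm) mconf measure)"
    using sets.top[of "borel_of (mconf_topology S) :: ('x, 'm) mconf measure"] S by simp
  ultimately show ?thesis by (simp only: sets.Diff)
qed

text \<open>An open set splits by number of points into the countable unions of
  \<open>open_n_eq\<close>. Conversely an open \<open>B\<close> is the difference
  \<open>B - {}\<close>, so \<open>voids_Diff_in_sets\<close> applies.\<close>

lemma sets_borel_of_mconf_topology:
  fixes S :: "'x::{metric_space, second_countable_topology} set"
  assumes S: "S \<in> Oc"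
  shows "sets (borel_of (mconf_topology S :: ('x, 'm::{metric_space, second_countable_topology}) mconf topology))
    = sigma_sets (mconfs S) (open_voids S)"
proof
  interpret sigma_algebra "mconfs S" "sigma_sets (mconfs S) (open_voids S) :: ('x, 'm) mconf set set"
    by (rule sigma_algebra_sigma_sets) (use voids_subset in auto)
  have "U \<in> sigma_sets (mconfs S) (open_voids S)" if U: "openin (mconf_topology S) U" for U :: "('x, 'm) mconf set"
  proof -
    have "U \<inter> mconfs_n S n \<in> sigma_sets (mconfs S) (open_voids S)" for n
    proof -
      have "openin (mconf_topology_n S n) (U \<inter> mconfs_n S n)" using U openin_mconf_topology by auto
      from open_n_eq[OF this] show ?thesis
        by (rule ssubst)
          (intro countable_UN' Int hits_in_sigma_voids mconfs_n_in_sigma_voids[OF S]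
             countable_subset[OF _ countable_basic_families] image_subsetI, auto)
    qed
    moreover have "U = (\<Union>n. U \<inter> mconfs_n S n)"
      using openin_subset[OF U] S mconfs_Union[OF S] by auto
    ultimately show ?thesis by (metis (no_types, lifting) countable_UN image_subsetI)
  qed
  then show "sets (borel_of (mconf_topology S)) \<subseteq> (sigma_sets (mconfs S) (open_voids S) :: ('x, 'm) mconf set set)"
    unfolding sets_borel_of topspace_mconf_topology[OF S] by (intro sigma_sets_subset subsetI) simp
  have "sigma_sets (mconfs S) (open_voids S) \<subseteq> sets (borel_of (mconf_topology S) :: ('x, 'm) mconf measure)"
    using sets.sigma_sets_subset[of "open_voids S" "borel_of (mconf_topology S) :: ('x, 'm) mconf measure"]
      voids_Diff_in_sets[OF S _ open_empty] S by auto
  then show "sigma_sets (mconfs S) (open_voids S) \<subseteq> sets (borel_of (mconf_topology S) :: ('x, 'm) mconf measure)" .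
qed


text \<open>The source is left abstract to serve twice: for the Borel space over another region, and
  for the \<sigma>-algebra generated by local voids before it is known to be that of
  \<open>mconf_space\<close>.\<close>

lemma mrestrict_measurable_if:
  fixes S :: "'x::{metric_space, second_countable_topology} set"
    and M :: "('x, 'm::{metric_space, second_countable_topology}) mconf measure"
  assumes S: "S \<in> Oc" and M: "space M = mconfs T"
    and "\<And>B. open B \<Longrightarrow> voids T (B \<inter> S \<times> UNIV) \<in> sets M"
  shows "mrestrict S \<in> M \<rightarrow>\<^sub>M borel_of (mconf_topology S)"
proof (rule measurable_sigma_sets[OF sets_borel_of_mconf_topology[OF S]])
  show "open_voids S \<subseteq> Pow (mconfs S)" using voids_subset by auto
  show "mrestrict S \<in> space M \<rightarrow> mconfs S" using mrestrict_mconfs by (auto simp: M)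
  fix V :: "('x, 'm) mconf set" assume "V \<in> open_voids S"
  then show "mrestrict S -` V \<inter> space M \<in> sets M"
    using assms(3) by (auto simp: M mrestrict_vimage_voids)
qed

lemma voids_in_sets:
  fixes B :: "('x::metric_space \<times> 'm::metric_space) set"
  assumes "S \<in> Oc" "open B"
  shows "voids S B \<in> sets (borel_of (mconf_topology S))"
  using voids_Diff_in_sets[OF assms open_empty] by simp

lemma open_Int_strip: "S \<in> Oc \<Longrightarrow> open B \<Longrightarrow> open (B \<inter> S \<times> UNIV)"
  by (simp add: Oc_def open_Int open_Times)

lemma mrestrict_measurable:
  fixes S :: "'x::{metric_space, second_countable_topology} set"
  assumes "S \<in> Oc" "T \<in> Oc"
  shows "mrestrict S \<in> borel_of (mconf_topology T :: ('x, 'm::{metric_space, second_countable_topology}) mconf topology)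
    \<rightarrow>\<^sub>M borel_of (mconf_topology S)"
  using assms by (intro mrestrict_measurable_if[where T=T] voids_in_sets open_Int_strip) auto

text \<open>The test set sits over one region in \<open>Oc\<close>, so a single restriction map sees
  the whole event and the prescribed marginals determine its probability.\<close>

definition local_voids :: "('x::metric_space, 'm::metric_space) mconf set set"
  where "local_voids = {voids UNIV B | B S. open B \<and> S \<in> Oc \<and> B \<subseteq> S \<times> UNIV}"

lemma cylinders_subset: "cylinders \<subseteq> Pow (mconfs UNIV)"
  by (auto simp: cylinders_def)

lemma space_mconf_space: "space mconf_space = mconfs UNIV"
  unfolding mconf_space_def by (rule space_measure_of[OF cylinders_subset])

lemma mrestrict_measurable_mconf_space:
  assumes "S \<in> Oc"
  shows "mrestrict S \<in> mconf_space \<rightarrow>\<^sub>M borel_of (mconf_topology S)"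
  unfolding borel_of_def
proof (rule measurable_measure_of)
  show "{U. openin (mconf_topology S) U} \<subseteq> Pow (topspace (mconf_topology S))"
    using openin_subset by fastforce
  show "mrestrict S \<in> space mconf_space \<rightarrow> topspace (mconf_topology S)"
    using mrestrict_mconfs assms by (auto simp: space_mconf_space)
  show "mrestrict S -` U \<inter> space mconf_space \<in> sets mconf_space" if "U \<in> {U. openin (mconf_topology S) U}" for U
    unfolding space_mconf_space unfolding mconf_space_def sets_measure_of[OF cylinders_subset]
    using that assms by (intro sigma_sets.Basic) (auto simp: cylinders_def)
qed

lemma local_voids_subset: "local_voids \<subseteq> Pow (mconfs UNIV)"
  using voids_subset by (auto simp: local_voids_def)

text \<open>Cylinders are preimages of open sets, so it suffices that each restriction map is
  measurable for the \<sigma>-algebra of local voids; conversely a local void is the preimage of an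
  open void under one restriction.\<close>

lemma sets_mconf_space:
  "sets (mconf_space :: ('x::{metric_space, second_countable_topology}, 'm::{metric_space, second_countable_topology}) mconf measure)
    = sigma_sets (mconfs UNIV) local_voids"
proof
  let ?G = "sigma (mconfs UNIV) local_voids :: ('x, 'm) mconf measure"
  have "C \<in> sets ?G" if C': "C \<in> cylinders" for C
  proof -
    obtain S U where C: "C = mrestrict S -` U \<inter> mconfs UNIV" "S \<in> Oc" "openin (mconf_topology S) U"
      using C' by (auto simp: cylinders_def)
    have "mrestrict S \<in> ?G \<rightarrow>\<^sub>M borel_of (mconf_topology S)"
    proof (rule mrestrict_measurable_if[OF C(2)])
      show "voids UNIV (B \<inter> S \<times> UNIV) \<in> sets ?G" if "open B" for B
        unfolding sets_measure_of[OF local_voids_subset] using open_Int_strip[OF C(2) that] C(2)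
        by (intro sigma_sets.Basic) (auto simp: local_voids_def)
    qed (simp add: local_voids_subset)
    from measurable_sets[OF this openin_sets_borel_of[OF C(3)]] show ?thesis
      by (simp add: C(1) local_voids_subset)
  qed
  then show "sets mconf_space \<subseteq> (sigma_sets (mconfs UNIV) local_voids :: ('x, 'm) mconf set set)"
    unfolding mconf_space_def sets_measure_of[OF cylinders_subset] sets_measure_of[OF local_voids_subset]
    by (intro sigma_sets_mono subsetI)
  have "V \<in> sets mconf_space" if V': "V \<in> local_voids" for V :: "('x, 'm) mconf set"
  proof -
    obtain B S where V: "V = voids UNIV B" "open B" "S \<in> Oc" "B \<subseteq> S \<times> UNIV"
      using V' by (auto simp: local_voids_def)
    have "B \<inter> S \<times> UNIV = B" using V(4) by auto
    then show ?thesis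
      using measurable_sets[OF mrestrict_measurable_mconf_space[OF V(3)] voids_in_sets[OF V(3,2)]] V(1)
      by (simp add: space_mconf_space mrestrict_vimage_voids)
  qed
  then show "sigma_sets (mconfs UNIV) local_voids \<subseteq> sets (mconf_space :: ('x, 'm) mconf measure)"
    using sets.sigma_sets_subset[of local_voids "mconf_space :: ('x, 'm) mconf measure"]
    by (auto simp: space_mconf_space)
qed

lemma Oc_empty: "{} \<in> Oc"
  by (simp add: Oc_def)

lemma Oc_Un: "S \<in> Oc \<Longrightarrow> T \<in> Oc \<Longrightarrow> S \<union> T \<in> Oc"
  by (simp add: Oc_def compact_Un open_Un)

lemma Int_stable_local_voids: "Int_stable local_voids"
proof (rule Int_stableI)
  fix V W :: "('a, 'b) mconf set" assume "V \<in> local_voids" "W \<in> local_voids"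
  then obtain B S C T where "V = voids UNIV B" "open B" "S \<in> Oc" "B \<subseteq> S \<times> UNIV"
    "W = voids UNIV C" "open C" "T \<in> Oc" "C \<subseteq> T \<times> UNIV"
    unfolding local_voids_def by blast
  then have "V \<inter> W = voids UNIV (B \<union> C) \<and> open (B \<union> C) \<and> S \<union> T \<in> Oc \<and> B \<union> C \<subseteq> (S \<union> T) \<times> UNIV"
    by (auto simp: voids_Int Oc_Un)
  then show "V \<inter> W \<in> local_voids" unfolding local_voids_def by blast
qed

section \<open>Void probabilities of the local measures\<close>

text \<open>Non-atomicity enters as nullity of singletons, which rules out coinciding positions; the
  Radon property enters as finiteness on compact sets, which makes the local measures
  finite.\<close>

locale poisson_data =
  fixes \<sigma> :: "'x::{metric_space, second_countable_topology} measure"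
    and \<tau> :: "'m::{metric_space, second_countable_topology} measure"
  assumes sets_position: "sets \<sigma> = sets borel"
    and finite_on_compact: "\<And>K. compact K \<Longrightarrow> emeasure \<sigma> K < \<infinity>"
    and null_singleton: "\<And>x. emeasure \<sigma> {x} = 0"
    and prob_mark: "prob_space \<tau>"
    and sets_mark: "sets \<tau> = sets borel"
begin

sublocale mark: prob_space \<tau> by (rule prob_mark)

abbreviation intensity :: "('x \<times> 'm) measure"
  where "intensity \<equiv> \<sigma> \<Otimes>\<^sub>M \<tau>"

abbreviation local_intensity :: "'x set \<Rightarrow> ('x \<times> 'm) measure"
  where "local_intensity S \<equiv> restrict_space \<sigma> S \<Otimes>\<^sub>M \<tau>"

lemma space_position: "space \<sigma> = UNIV"
  using sets_eq_imp_space_eq[OF sets_position] by simp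

lemma space_mark: "space \<tau> = UNIV"
  using sets_eq_imp_space_eq[OF sets_mark] by simp

lemma sets_intensity: "sets intensity = sets borel"
  unfolding borel_prod[symmetric] by (rule sets_pair_measure_cong[OF sets_position sets_mark])

lemma space_local_intensity: "space (local_intensity S) = S \<times> UNIV"
  by (simp add: space_pair_measure space_restrict_space space_position space_mark)

text \<open>Transfers Borel sets of the product space to the product with restricted first factor,
  whose \<sigma>-algebra is not literally a trace.\<close>

lemma id_measurable_local: "(\<lambda>p. p) \<in> borel_measurable (local_intensity S)"
proof -
  have "(\<lambda>x. x) \<in> restrict_space \<sigma> S \<rightarrow>\<^sub>M borel"
    by (rule measurable_restrict_space1) (simp add: measurable_ident_sets sets_position)
  then have 1: "fst \<in> local_intensity S \<rightarrow>\<^sub>M borel"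
    using measurable_compose[OF measurable_fst] by fastforce
  have "(\<lambda>x. x) \<in> \<tau> \<rightarrow>\<^sub>M borel"
    by (simp add: measurable_ident_sets sets_mark)
  then have 2: "snd \<in> local_intensity S \<rightarrow>\<^sub>M borel"
    using measurable_compose[OF measurable_snd] by fastforce
  show ?thesis using borel_measurable_Pair[OF 1 2] by simp
qed

lemma in_sets_local: "B \<in> sets borel \<Longrightarrow> B \<inter> S \<times> UNIV \<in> sets (local_intensity S)"
  using measurable_sets[OF id_measurable_local] by (simp add: space_local_intensity)

lemma Oc_borel: "S \<in> Oc \<Longrightarrow> S \<in> sets borel"
  by (simp add: Oc_def)

lemma times_borel: "S \<in> Oc \<Longrightarrow> S \<times> UNIV \<in> sets borel"
  by (simp add: Oc_def open_Times)

text \<open>Slices over positions outside \<open>S\<close> are empty, so by Fubini restricting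
  \<sigma> first changes nothing. This lets void probabilities be written with one intensity that
  does not mention \<open>S\<close>.\<close>

lemma emeasure_local_intensity:
  assumes S: "S \<in> Oc" and B: "B \<in> sets borel"
  shows "emeasure (local_intensity S) (B \<inter> S \<times> UNIV) = emeasure intensity (B \<inter> S \<times> UNIV)"
proof -
  let ?B = "B \<inter> S \<times> UNIV"
  have "?B \<in> sets intensity" unfolding sets_intensity using B times_borel[OF S] by (rule sets.Int)
  then have "emeasure intensity ?B = (\<integral>\<^sup>+x. emeasure \<tau> (Pair x -` ?B) \<partial>\<sigma>)"
    by (rule mark.emeasure_pair_measure_alt)
  also have "\<dots> = (\<integral>\<^sup>+x. emeasure \<tau> (Pair x -` ?B) * indicator S x \<partial>\<sigma>)"
  proof (intro nn_integral_cong)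
    fix x show "emeasure \<tau> (Pair x -` ?B) = emeasure \<tau> (Pair x -` ?B) * indicator S x"
      by (cases "x \<in> S") auto
  qed
  also have "\<dots> = (\<integral>\<^sup>+x. emeasure \<tau> (Pair x -` ?B) \<partial>restrict_space \<sigma> S)"
    using Oc_borel[OF S] by (subst nn_integral_restrict_space) (auto simp: sets_position space_position)
  also have "\<dots> = emeasure (local_intensity S) ?B"
    using in_sets_local[OF B] by (rule mark.emeasure_pair_measure_alt[symmetric])
  finally show ?thesis by simp
qed

lemma emeasure_strip:
  assumes "S \<in> Oc"
  shows "emeasure intensity (S \<times> UNIV) = emeasure \<sigma> S"
  using mark.emeasure_pair_measure_Times[of S \<sigma> UNIV] assms mark.emeasure_space_1
  by (simp add: sets_position sets_mark Oc_borel space_mark)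

lemma emeasure_position_finite:
  assumes "S \<in> Oc"
  shows "emeasure \<sigma> S < \<infinity>"
proof -
  have "emeasure \<sigma> S \<le> emeasure \<sigma> (closure S)"
    by (rule emeasure_mono) (auto simp: closure_subset sets_position)
  then show ?thesis using finite_on_compact[of "closure S"] assms by (auto simp: Oc_def)
qed

lemma finite_local_intensity:
  assumes "S \<in> Oc"
  shows "finite_measure (local_intensity S)"
  using emeasure_strip[OF assms] emeasure_local_intensity[OF assms, of UNIV] emeasure_position_finite[OF assms]
  by (intro finite_measureI) (simp add: space_local_intensity)

section \<open>Tuples with coinciding positions are negligible\<close>

abbreviation tuple_measure :: "'x set \<Rightarrow> nat \<Rightarrow> (nat \<Rightarrow> 'x \<times> 'm) measure"
  where "tuple_measure S n \<equiv> \<Pi>\<^sub>M i\<in>{..<n}. local_intensity S"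

lemma component_measurable: "i < n \<Longrightarrow> (\<lambda>z. z i) \<in> borel_measurable (tuple_measure S n)"
  using measurable_compose[OF measurable_component_singleton[of i "{..<n}" "\<lambda>_. local_intensity S"] id_measurable_local] by simp

lemma space_tuple_measure: "space (tuple_measure S n) = {..<n} \<rightarrow>\<^sub>E S \<times> UNIV"
  by (simp add: space_PiM space_local_intensity)

lemma coincidence_in_sets:
  assumes "i < n" "j < n"
  shows "{z \<in> space (tuple_measure S n). fst (z i) = fst (z j)} \<in> sets (tuple_measure S n)"
proof -
  have f: "(\<lambda>z. fst (z k)) \<in> borel_measurable (tuple_measure S n)" if "k < n" for k
    using component_measurable[OF that] by (rule measurable_compose) (auto intro!: borel_measurable_continuous_onI continuous_intros)
  have "closed {p :: 'x \<times> 'x. fst p = snd p}"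
    by (intro closed_Collect_eq continuous_intros)
  then have "{p :: 'x \<times> 'x. fst p = snd p} \<in> sets borel" by simp
  from measurable_sets[OF borel_measurable_Pair[OF f[OF assms(1)] f[OF assms(2)]] this]
  show ?thesis by (rule back_subst[where P="\<lambda>X. X \<in> _"]) auto
qed

lemma dtuples_eq:
  "dtuples S n = space (tuple_measure S n) -
     (\<Union>i<n. \<Union>j\<in>{..<n} - {i}. {z \<in> space (tuple_measure S n). fst (z i) = fst (z j)})"
  by (auto simp: dtuples_def space_tuple_measure inj_on_def)

lemma dtuples_in_sets: "dtuples S n \<in> sets (tuple_measure S n)"
  unfolding dtuples_eq
  by (intro sets.Diff sets.top sets.finite_UN coincidence_in_sets) auto

text \<open>Fubini in coordinate \<open>j\<close>: once the other coordinates are fixed, that point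
  must lie over the single position of coordinate \<open>i\<close>, and a strip over a singleton is
  null.\<close>

lemma coincidence_null:
  assumes S: "S \<in> Oc" and ij: "i < n" "j < n" "i \<noteq> j"
  shows "emeasure (tuple_measure S n) {z \<in> space (tuple_measure S n). fst (z i) = fst (z j)} = 0"
proof -
  interpret L: finite_measure "local_intensity S" by (rule finite_local_intensity[OF S])
  interpret product_sigma_finite "\<lambda>_::nat. local_intensity S"
    by (rule product_sigma_finite.intro) unfold_locales
  let ?D = "{z \<in> space (tuple_measure S n). fst (z i) = fst (z j)}"
  define J where "J = {..<n} - {j}"
  have J: "finite J" "j \<notin> J" "insert j J = {..<n}" "i \<in> J" using ij by (auto simp: J_def)
  have "emeasure (tuple_measure S n) ?D = (\<integral>\<^sup>+z. indicator ?D z \<partial>tuple_measure S n)"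
    using coincidence_in_sets[OF ij(1,2)] by simp
  also have "\<dots> = (\<integral>\<^sup>+x. (\<integral>\<^sup>+y. indicator ?D (x(j := y)) \<partial>local_intensity S) \<partial>(\<Pi>\<^sub>M i\<in>J. local_intensity S))"
    using product_nn_integral_insert[OF J(1,2), of "indicator ?D"] coincidence_in_sets[OF ij(1,2)] J(3)
    by simp
  also have "\<dots> = (\<integral>\<^sup>+x. 0 \<partial>(\<Pi>\<^sub>M i\<in>J. local_intensity S))"
  proof (intro nn_integral_cong)
    fix x assume "x \<in> space (\<Pi>\<^sub>M i\<in>J. local_intensity S)"
    have B: "{fst (x i)} \<times> (UNIV::'m set) \<in> sets borel" by (intro borel_closed closed_Times) auto
    have "(\<integral>\<^sup>+y. indicator ?D (x(j := y)) \<partial>local_intensity S)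
        \<le> (\<integral>\<^sup>+y. indicator ({fst (x i)} \<times> UNIV \<inter> S \<times> UNIV) y \<partial>local_intensity S)"
      using ij by (intro nn_integral_mono) (auto simp: space_local_intensity split: split_indicator)
    also have "\<dots> = emeasure intensity ({fst (x i)} \<times> UNIV \<inter> S \<times> UNIV)"
      using in_sets_local[OF B] emeasure_local_intensity[OF S B] by simp
    also have "\<dots> \<le> emeasure intensity ({fst (x i)} \<times> UNIV)"
      by (rule emeasure_mono) (use B sets_intensity in auto)
    also have "\<dots> = 0"
      using mark.emeasure_pair_measure_Times[of "{fst (x i)}" \<sigma> UNIV] null_singleton
      by (simp add: sets_position sets_mark)
    finally show "(\<integral>\<^sup>+y. indicator ?D (x(j := y)) \<partial>local_intensity S) = 0" by simp
  qed
  finally show ?thesis by simp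
qed

lemma AE_dtuples:
  assumes S: "S \<in> Oc"
  shows "AE z in tuple_measure S n. z \<in> dtuples S n"
proof -
  have "(\<Union>i<n. \<Union>j\<in>{..<n} - {i}. {z \<in> space (tuple_measure S n). fst (z i) = fst (z j)}) \<in> null_sets (tuple_measure S n)"
    by (intro null_sets.finite_UN) (auto intro!: null_setsI coincidence_null[OF S] coincidence_in_sets)
  then show ?thesis by (rule AE_I') (auto simp: dtuples_eq)
qed

text \<open>By \<open>open_n_eq\<close> only hitting events need pulling back, and hitting
  \<open>B\<close> means that some coordinate of the tuple lies in \<open>B\<close>.\<close>

lemma mconf_of_measurable:
  "mconf_of n \<in> restrict_space (tuple_measure S n) (dtuples S n) \<rightarrow>\<^sub>M borel_of (mconf_topology_n S n)"
  unfolding borel_of_def topspace_mconf_topology_n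
proof (rule measurable_measure_of)
  let ?R = "restrict_space (tuple_measure S n) (dtuples S n)"
  have sp: "space ?R = dtuples S n"
    using sets.sets_into_space[OF dtuples_in_sets] by (auto simp: space_restrict_space)
  show "{U. openin (mconf_topology_n S n) U} \<subseteq> Pow (mconfs_n S n)"
    using openin_subset by fastforce
  show "mconf_of n \<in> space ?R \<rightarrow> mconfs_n S n" unfolding sp by (auto intro: mconf_of_in_mconfs_n)
  fix W :: "('x, 'm) mconf set" assume "W \<in> {U. openin (mconf_topology_n S n) U}"
  then have W: "openin (mconf_topology_n S n) W" by simp
  have c: "{z \<in> dtuples S n. z i \<in> B} \<in> sets ?R" if "i < n" "open B" for i B
  proof -
    have "(\<lambda>z. z i) \<in> borel_measurable ?R"
      using component_measurable[OF that(1)] by (rule measurable_restrict_space1)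
    from measurable_sets[OF this, of B] that(2) show ?thesis
      unfolding sp by (simp add: vimage_def Int_def conj_commute)
  qed
  have h: "mconf_of n -` (hits S F \<inter> mconfs_n S n) \<inter> space ?R \<in> sets ?R" if F: "F \<in> basic_families" for F
  proof -
    have eq: "mconf_of n -` (hits S F \<inter> mconfs_n S n) \<inter> space ?R
        = space ?R \<inter> (\<Inter>B\<in>F. \<Union>i<n. {z \<in> dtuples S n. z i \<in> B})" (is "?L = ?R'")
    proof (intro set_eqI)
      fix z show "z \<in> ?L \<longleftrightarrow> z \<in> ?R'"
      proof (cases "z \<in> dtuples S n")
        case True
        have "mconf_of n z \<in> mconfs_n S n" "mconf_of n z \<in> mconfs S"
          using mconf_of_in_mconfs_n[OF True] mconfs_n_subset by auto
        then show ?thesis using True unfolding hits_def sp by (auto simp: pts_mconf_of[OF True])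
      qed (simp add: sp)
    qed
    have "(\<Union>i<n. {z \<in> dtuples S n. z i \<in> B}) \<in> sets ?R" if "B \<in> F" for B
      using basic_familiesD(3)[OF F that] by (intro sets.finite_UN c) auto
    then show ?thesis
      unfolding eq using basic_familiesD(1)[OF F]
      by (cases "F = {}") (simp_all add: sets.Int sets.finite_INT del: INT_simps)
  qed
  have "mconf_of n -` W \<inter> space ?R
      = (\<Union>F\<in>{F\<in>basic_families. hits S F \<inter> mconfs_n S n \<subseteq> W}. mconf_of n -` (hits S F \<inter> mconfs_n S n) \<inter> space ?R)"
    by (subst open_n_eq[OF W]) blast
  also have "\<dots> \<in> sets ?R"
    by (intro sets.countable_UN' countable_subset[OF _ countable_basic_families] image_subsetI h) auto
  finally show "mconf_of n -` W \<inter> space ?R \<in> sets ?R" .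
qed

section \<open>Evaluation of the local measures\<close>

lemma Int_mconfs_n_in_sets:
  assumes "S \<in> Oc" "A \<in> sets (borel_of (mconf_topology S))"
  shows "A \<inter> mconfs_n S n \<in> sets (borel_of (mconf_topology_n S n))"
proof -
  have "(\<lambda>\<omega>. \<omega>) \<in> borel_of (mconf_topology_n S n) \<rightarrow>\<^sub>M borel_of (mconf_topology S)"
    unfolding borel_of_def[of "mconf_topology S"]
  proof (rule measurable_measure_of)
    show "{U. openin (mconf_topology S) U} \<subseteq> Pow (topspace (mconf_topology S))"
      using openin_subset by fastforce
    show "(\<lambda>\<omega>. \<omega>) \<in> space (borel_of (mconf_topology_n S n)) \<rightarrow> topspace (mconf_topology S)"
      using mconfs_n_subset by (auto simp: assms(1))
    show "(\<lambda>\<omega>. \<omega>) -` U \<inter> space (borel_of (mconf_topology_n S n)) \<in> sets (borel_of (mconf_topology_n S n))"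
      if "U \<in> {U. openin (mconf_topology S) U}" for U
      using that by (simp add: openin_mconf_topology openin_sets_borel_of)
  qed
  from measurable_sets[OF this assms(2)] show ?thesis by simp
qed

lemma sets_lebesgue_poisson_n: "sets (lebesgue_poisson_n \<sigma> \<tau> S n) = sets (borel_of (mconf_topology_n S n))"
  by (simp add: lebesgue_poisson_n_def)

text \<open>Up to null coincidences, the tuples avoiding \<open>B\<close> form a product set, whose
  mass is a power. Measurability of the void event is assumed separately, so that the formula also
  covers test sets cut to cells, which need not be open.\<close>

lemma emeasure_lebesgue_poisson_n_voids:
  assumes S: "S \<in> Oc" and B: "B \<in> sets borel"
    and V: "voids S B \<in> sets (borel_of (mconf_topology S))"
  shows "emeasure (lebesgue_poisson_n \<sigma> \<tau> S n) (voids S B \<inter> mconfs_n S n)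
    = 1 / fact n * emeasure (local_intensity S) (S \<times> UNIV - B) ^ n"
proof -
  interpret L: finite_measure "local_intensity S" by (rule finite_local_intensity[OF S])
  interpret product_sigma_finite "\<lambda>_::nat. local_intensity S"
    by (rule product_sigma_finite.intro) unfold_locales
  let ?c = "1 / fact n :: ennreal" and ?P = "tuple_measure S n" and ?D = "dtuples S n"
  let ?E = "{..<n} \<rightarrow>\<^sub>E S \<times> UNIV - B"
  let ?R = "restrict_space (scale_measure ?c ?P) ?D"
  have D: "?D \<subseteq> space ?P" using sets.sets_into_space[OF dtuples_in_sets] .
  have C: "S \<times> UNIV - B \<in> sets (local_intensity S)"
    using in_sets_local[of "- B" S] B by (simp add: Diff_eq Int_commute)
  have E: "?E \<in> sets ?P" using C by (intro sets_PiM_I_finite) auto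
  have m: "mconf_of n \<in> ?R \<rightarrow>\<^sub>M borel_of (mconf_topology_n S n)"
    using mconf_of_measurable[of n S]
    by (subst measurable_cong_sets[OF sets_restrict_space_cong[OF sets_scale_measure] refl])
  have pre: "mconf_of n -` (voids S B \<inter> mconfs_n S n) \<inter> space ?R = ?E \<inter> ?D" (is "?L = _")
  proof (intro set_eqI)
    fix z show "z \<in> ?L \<longleftrightarrow> z \<in> ?E \<inter> ?D"
    proof (cases "z \<in> ?D")
      case True
      have z: "mconf_of n z \<in> mconfs_n S n" "mconf_of n z \<in> mconfs S"
        using mconf_of_in_mconfs_n[OF True] mconfs_n_subset by auto
      have "z \<in> {..<n} \<rightarrow>\<^sub>E S \<times> UNIV" using True by (simp add: dtuples_def)
      then have "z \<in> ?E \<longleftrightarrow> z ` {..<n} \<inter> B = {}"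
        by (auto simp: PiE_def Pi_def)
      then show ?thesis using True D z
        by (auto simp: voids_def pts_mconf_of[OF True] space_restrict_space space_scale_measure)
    qed (simp add: space_restrict_space)
  qed
  have "emeasure (lebesgue_poisson_n \<sigma> \<tau> S n) (voids S B \<inter> mconfs_n S n) = emeasure ?R (?E \<inter> ?D)"
    unfolding lebesgue_poisson_n_def pre[symmetric]
    by (rule emeasure_distr[OF m Int_mconfs_n_in_sets[OF S V]])
  also have "\<dots> = ?c * emeasure ?P (?E \<inter> ?D)"
    using dtuples_in_sets D by (subst emeasure_restrict_space) (auto simp: space_scale_measure Int_absorb2)
  also have "emeasure ?P (?E \<inter> ?D) = emeasure ?P ?E"
    by (rule emeasure_eq_AE) (use AE_dtuples[OF S, of n] E dtuples_in_sets in auto)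
  also have "\<dots> = emeasure (local_intensity S) (S \<times> UNIV - B) ^ n"
    using C by (subst emeasure_PiM) auto
  finally show ?thesis .
qed

lemma sets_marked_poisson_on:
  assumes "S \<in> Oc"
  shows "sets (marked_poisson_on \<sigma> \<tau> S) = sets (borel_of (mconf_topology S))"
proof -
  have "mconfs S = space (borel_of (mconf_topology S) :: ('x, 'm) mconf measure)" using assms by simp
  then show ?thesis unfolding marked_poisson_on_def lebesgue_poisson_def
    by (simp only: sets_scale_measure sets.sets_measure_of_eq)
qed

lemma space_marked_poisson_on:
  assumes "S \<in> Oc"
  shows "space (marked_poisson_on \<sigma> \<tau> S) = mconfs S"
  using sets_eq_imp_space_eq[OF sets_marked_poisson_on[OF assms]] assms by simp

text \<open>\<open>measure_of\<close> takes the values of the given formula only if that formula is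
  a measure; the point is countable additivity, an exchange of two nonnegative sums made through
  counting measure.\<close>

lemma emeasure_lebesgue_poisson:
  assumes S: "S \<in> Oc" and A: "A \<in> sets (borel_of (mconf_topology S))"
  shows "emeasure (lebesgue_poisson \<sigma> \<tau> S) A
    = (\<Sum>n. emeasure (lebesgue_poisson_n \<sigma> \<tau> S n) (A \<inter> mconfs_n S n))"
  unfolding lebesgue_poisson_def
proof (rule emeasure_measure_of_sigma)
  let ?\<S> = "sets (borel_of (mconf_topology S) :: ('x, 'm) mconf measure)"
  let ?e = "\<lambda>n A. emeasure (lebesgue_poisson_n \<sigma> \<tau> S n) (A \<inter> mconfs_n S n)"
  show "sigma_algebra (mconfs S) ?\<S>"
    using sets.sigma_algebra_axioms[of "borel_of (mconf_topology S) :: ('x, 'm) mconf measure"] S by simp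
  show "positive ?\<S> (\<lambda>A. \<Sum>n. ?e n A)" by (simp add: positive_def)
  show "countably_additive ?\<S> (\<lambda>A. \<Sum>n. ?e n A)"
  proof (rule countably_additiveI)
    fix A :: "nat \<Rightarrow> ('x, 'm) mconf set"
    assume A: "range A \<subseteq> ?\<S>" "disjoint_family A" "\<Union> (range A) \<in> ?\<S>"
    have "(\<Sum>i. \<Sum>n. ?e n (A i)) = (\<Sum>i. \<integral>\<^sup>+n. ?e n (A i) \<partial>count_space UNIV)"
      by (simp add: nn_integral_count_space_nat)
    also have "\<dots> = (\<integral>\<^sup>+n. (\<Sum>i. ?e n (A i)) \<partial>count_space UNIV)"
      by (rule nn_integral_suminf[symmetric]) simp
    also have "\<dots> = (\<Sum>n. \<Sum>i. ?e n (A i))"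
      by (simp add: nn_integral_count_space_nat)
    also have "\<dots> = (\<Sum>n. ?e n (\<Union> (range A)))"
    proof (rule suminf_cong)
      fix n
      have "(\<Sum>i. ?e n (A i)) = emeasure (lebesgue_poisson_n \<sigma> \<tau> S n) (\<Union>i. A i \<inter> mconfs_n S n)"
      proof (rule suminf_emeasure)
        show "range (\<lambda>i. A i \<inter> mconfs_n S n) \<subseteq> sets (lebesgue_poisson_n \<sigma> \<tau> S n)"
          using A(1) Int_mconfs_n_in_sets[OF S] by (auto simp: sets_lebesgue_poisson_n)
        show "disjoint_family (\<lambda>i. A i \<inter> mconfs_n S n)"
          using A(2) by (auto simp: disjoint_family_on_def)
      qed
      then show "(\<Sum>i. ?e n (A i)) = ?e n (\<Union> (range A))" by simp
    qed
    finally show "(\<Sum>i. \<Sum>n. ?e n (A i)) = (\<Sum>n. ?e n (\<Union> (range A)))" .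
  qed
qed (rule A)

text \<open>With \<open>a\<close> the mass of the strip off \<open>B\<close>, the strata sum to
  \<open>exp a\<close>. The normalisation subtracts the mass of the whole strip in the exponent,
  leaving minus the mass of the part in \<open>B\<close>; finiteness allows this subtraction in the
  reals.\<close>

lemma emeasure_marked_poisson_on_voids:
  assumes S: "S \<in> Oc" and B: "B \<in> sets borel"
    and V: "voids S B \<in> sets (borel_of (mconf_topology S))"
  shows "emeasure (marked_poisson_on \<sigma> \<tau> S) (voids S B) = ennreal (exp (- measure intensity (B \<inter> S \<times> UNIV)))"
proof -
  interpret L: finite_measure "local_intensity S" by (rule finite_local_intensity[OF S])
  define a where "a = measure (local_intensity S) (S \<times> UNIV - B)"
  have a: "a \<ge> 0" by (simp add: a_def)
  have summand: "emeasure (lebesgue_poisson_n \<sigma> \<tau> S n) (voids S B \<inter> mconfs_n S n) = ennreal (a ^ n /\<^sub>R fact n)" for n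
  proof -
    have "emeasure (lebesgue_poisson_n \<sigma> \<tau> S n) (voids S B \<inter> mconfs_n S n) = 1 / fact n * ennreal a ^ n"
      using emeasure_lebesgue_poisson_n_voids[OF assms] by (simp add: a_def L.emeasure_eq_measure)
    also have "(1 / fact n :: ennreal) = ennreal (1 / fact n)"
      by (metis divide_ennreal ennreal_1 ennreal_of_nat_eq_real_of_nat fact_gt_zero of_nat_fact zero_le_one)
    also have "\<dots> * ennreal a ^ n = ennreal (a ^ n /\<^sub>R fact n)"
      using a by (simp add: ennreal_power ennreal_mult[symmetric] divide_inverse)
    finally show ?thesis .
  qed
  have "emeasure (lebesgue_poisson \<sigma> \<tau> S) (voids S B) = ennreal (exp a)"
    unfolding emeasure_lebesgue_poisson[OF S V] summand
    by (rule suminf_ennreal_eq) (use a exp_converges[of a] in auto)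
  then have "emeasure (marked_poisson_on \<sigma> \<tau> S) (voids S B) = ennreal (exp (a - measure \<sigma> S))"
    by (simp add: marked_poisson_on_def ennreal_mult[symmetric] exp_add[symmetric])
  moreover have "measure \<sigma> S = measure (local_intensity S) (S \<times> UNIV)"
    using emeasure_strip[OF S] emeasure_local_intensity[OF S, of UNIV] by (simp add: measure_def)
  moreover have "measure (local_intensity S) (S \<times> UNIV) = a + measure (local_intensity S) (B \<inter> S \<times> UNIV)"
  proof -
    have "S \<times> UNIV - B = S \<times> UNIV - B \<inter> S \<times> UNIV" by auto
    then show ?thesis
      using L.finite_measure_Diff[of "S \<times> UNIV" "B \<inter> S \<times> UNIV"] in_sets_local[OF B, of S] in_sets_local[of UNIV S]
      by (simp add: a_def)
  qed
  moreover have "measure (local_intensity S) (B \<inter> S \<times> UNIV) = measure intensity (B \<inter> S \<times> UNIV)"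
    using emeasure_local_intensity[OF S B] by (simp add: measure_def)
  ultimately show ?thesis by simp
qed

subsection \<open>Consistency and uniqueness\<close>

lemma prob_space_marked_poisson_on:
  assumes "S \<in> Oc"
  shows "prob_space (marked_poisson_on \<sigma> \<tau> S)"
  using emeasure_marked_poisson_on_voids[OF assms _ voids_in_sets[OF assms open_empty]] assms
  by (intro prob_spaceI) (simp add: space_marked_poisson_on voids_empty)

text \<open>Open voids generate the Borel sets and are stable under intersection, since test sets
  unite; the empty test set supplies the whole space with finite mass. Both consistency and
  existence end in this criterion.\<close>

lemma marked_poisson_on_eqI:
  assumes S: "S \<in> Oc" and M: "sets M = sets (borel_of (mconf_topology S))"
    and eq: "\<And>B. open B \<Longrightarrow> emeasure M (voids S B) = ennreal (exp (- measure intensity (B \<inter> S \<times> UNIV)))"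
  shows "M = marked_poisson_on \<sigma> \<tau> S"
proof (rule measure_eqI_generator_eq[where E="open_voids S" and \<Omega>="mconfs S" and A="\<lambda>_. voids S {}"])
  show "Int_stable (open_voids S :: ('x, 'm) mconf set set)"
  proof (rule Int_stableI)
    fix V W :: "('x, 'm) mconf set" assume "V \<in> open_voids S" "W \<in> open_voids S"
    then obtain B C where "V = voids S B" "W = voids S C" "open B" "open C" by auto
    then have "V \<inter> W = voids S (B \<union> C)" "open (B \<union> C)" by (simp_all add: voids_Int open_Un)
    then show "V \<inter> W \<in> open_voids S" by blast
  qed
  show "emeasure M V = emeasure (marked_poisson_on \<sigma> \<tau> S) V" if "V \<in> open_voids S" for V
    using that eq emeasure_marked_poisson_on_voids[OF S _ voids_in_sets[OF S]] by auto
  show "range (\<lambda>_. voids S {}) \<subseteq> open_voids S" by blast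
  show "emeasure M (voids S {}) \<noteq> \<infinity>" using eq[OF open_empty] by simp
qed (use voids_subset M sets_borel_of_mconf_topology[OF S] sets_marked_poisson_on[OF S] in \<open>auto simp: voids_empty\<close>)

text \<open>The pulled-back test set already lies over \<open>S\<close>, so cutting it by the strip
  over \<open>T\<close> does nothing and \<open>T\<close> disappears from the void
  probability.\<close>

lemma marked_poisson_on_consistent:
  assumes S: "S \<in> Oc" and T: "T \<in> Oc" and "S \<subseteq> T"
  shows "mrestrict S \<in> marked_poisson_on \<sigma> \<tau> T \<rightarrow>\<^sub>M borel_of (mconf_topology S)"
    and "distr (marked_poisson_on \<sigma> \<tau> T) (borel_of (mconf_topology S)) (mrestrict S) = marked_poisson_on \<sigma> \<tau> S"
proof -
  show m: "mrestrict S \<in> marked_poisson_on \<sigma> \<tau> T \<rightarrow>\<^sub>M borel_of (mconf_topology S)"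
    using mrestrict_measurable[OF S T] by (subst measurable_cong_sets[OF sets_marked_poisson_on[OF T] refl])
  show "distr (marked_poisson_on \<sigma> \<tau> T) (borel_of (mconf_topology S)) (mrestrict S) = marked_poisson_on \<sigma> \<tau> S"
  proof (rule marked_poisson_on_eqI[OF S])
    fix B :: "('x \<times> 'm) set" assume B: "open B"
    have "B \<inter> S \<times> UNIV \<inter> T \<times> UNIV = B \<inter> S \<times> UNIV" using \<open>S \<subseteq> T\<close> by auto
    then show "emeasure (distr (marked_poisson_on \<sigma> \<tau> T) (borel_of (mconf_topology S)) (mrestrict S)) (voids S B)
        = ennreal (exp (- measure intensity (B \<inter> S \<times> UNIV)))"
      using emeasure_marked_poisson_on_voids[OF T borel_open voids_in_sets[OF T], OF open_Int_strip open_Int_strip, OF S B S B]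
      by (simp add: emeasure_distr[OF m voids_in_sets[OF S B]] space_marked_poisson_on[OF T] mrestrict_vimage_voids)
  qed simp
qed

lemma marked_poisson_unique:
  assumes M: "sets M = sets mconf_space" "\<And>S. S \<in> Oc \<Longrightarrow> distr M (borel_of (mconf_topology S)) (mrestrict S) = marked_poisson_on \<sigma> \<tau> S"
    and N: "sets N = sets mconf_space" "\<And>S. S \<in> Oc \<Longrightarrow> distr N (borel_of (mconf_topology S)) (mrestrict S) = marked_poisson_on \<sigma> \<tau> S"
  shows "M = N"
proof -
  have *: "emeasure M (voids UNIV B) = emeasure (marked_poisson_on \<sigma> \<tau> S) (voids S B)"
    if M: "sets M = sets mconf_space" "\<And>S. S \<in> Oc \<Longrightarrow> distr M (borel_of (mconf_topology S)) (mrestrict S) = marked_poisson_on \<sigma> \<tau> S"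
      and B: "open B" "S \<in> Oc" "B \<subseteq> S \<times> UNIV" for M B S
  proof -
    have "mrestrict S \<in> M \<rightarrow>\<^sub>M borel_of (mconf_topology S)"
      using mrestrict_measurable_mconf_space[OF B(2)] by (subst measurable_cong_sets[OF M(1) refl])
    moreover have "B \<inter> S \<times> UNIV = B" using B(3) by auto
    ultimately show ?thesis
      using sets_eq_imp_space_eq[OF M(1)]
      by (simp add: M(2)[OF B(2), symmetric] emeasure_distr voids_in_sets[OF B(2,1)] mrestrict_vimage_voids space_mconf_space)
  qed
  show ?thesis
  proof (rule measure_eqI_generator_eq[OF Int_stable_local_voids local_voids_subset, where A="\<lambda>_. voids UNIV {}"])
    show "emeasure M V = emeasure N V" if V: "V \<in> local_voids" for V
    proof -
      obtain B S where "V = voids UNIV B" "open B" "S \<in> Oc" "B \<subseteq> S \<times> UNIV"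
        using V unfolding local_voids_def by blast
      then show ?thesis using *[OF M] *[OF N] by metis
    qed
    \<comment> \<open>Since \<open>{}\<close> is in \<open>Oc\<close>, the whole space is itself a
      local void, and its mass is read off the marginal over the empty region.\<close>
    show "range (\<lambda>_. voids UNIV {}) \<subseteq> local_voids"
      using Oc_empty by (auto simp: local_voids_def intro!: exI[of _ "{}"])
    show "emeasure M (voids UNIV {}) \<noteq> \<infinity>"
      using *[OF M open_empty Oc_empty empty_subsetI] emeasure_marked_poisson_on_voids[OF Oc_empty _ voids_in_sets[OF Oc_empty open_empty]] by simp
  qed (use M N in \<open>auto simp: sets_mconf_space voids_empty\<close>)
qed

end

section \<open>Existence by superposition\<close>

text \<open>Each \<open>w i\<close> may live on a region larger than \<open>C i\<close> and is
  trimmed to it. For disjoint \<open>C\<close>, positions from different indices never collide, and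
  \<open>THE\<close> finds the index that supplies the mark.\<close>

definition superpose :: "(nat \<Rightarrow> 'x set) \<Rightarrow> (nat \<Rightarrow> ('x, 'm) mconf) \<Rightarrow> ('x, 'm) mconf"
  where "superpose C w =
    (\<Union>i. fst (w i) \<inter> C i, \<lambda>x\<in>(\<Union>i. fst (w i) \<inter> C i). snd (w (THE i. x \<in> C i)) x)"

lemma pts_superpose:
  assumes "disjoint_family C"
  shows "pts (superpose C w) = (\<Union>i. pts (w i) \<inter> C i \<times> UNIV)"
proof -
  have the: "(THE i. x \<in> C i) = j" if "x \<in> C j" for x j
    using assms that by (intro the_equality) (auto simp: disjoint_family_on_def)
  have "pts (superpose C w) = (\<Union>i. (\<lambda>x. (x, snd (w (THE i. x \<in> C i)) x)) ` (fst (w i) \<inter> C i))"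
    by (auto simp: pts_def superpose_def image_UN[symmetric] intro!: image_cong)
  also have "\<dots> = (\<Union>i. (\<lambda>x. (x, snd (w i) x)) ` (fst (w i) \<inter> C i))"
    by (intro SUP_cong image_cong refl) (auto simp: the)
  also have "\<dots> = (\<Union>i. pts (w i) \<inter> C i \<times> UNIV)"
    by (auto simp: pts_def)
  finally show ?thesis .
qed

lemma superpose_mconfs:
  assumes "\<And>i. w i \<in> mconfs (L i)" and loc: "\<And>K. compact K \<Longrightarrow> finite {i. C i \<inter> K \<noteq> {}}"
  shows "superpose C w \<in> mconfs UNIV"
proof -
  have "finite ((\<Union>i. fst (w i) \<inter> C i) \<inter> K)" if K: "compact K" for K
  proof (rule finite_subset)
    show "(\<Union>i. fst (w i) \<inter> C i) \<inter> K \<subseteq> (\<Union>i\<in>{i. C i \<inter> K \<noteq> {}}. fst (w i) \<inter> K)" by auto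
    have "finite (fst (w i) \<inter> K)" for i
      using assms(1)[of i] K by (auto simp: mconfs_def configs_def)
    then show "finite (\<Union>i\<in>{i. C i \<inter> K \<noteq> {}}. fst (w i) \<inter> K)" using loc[OF K] by (intro finite_UN_I)
  qed
  then show ?thesis unfolding superpose_def mconfs_def configs_def by (simp only: mem_Collect_eq prod.case) auto
qed

text \<open>Finitely many members of the cover contain \<open>K\<close>; every later cell has these
  members removed, hence misses \<open>K\<close>.\<close>

lemma disjointed_locally_finite:
  fixes L :: "nat \<Rightarrow> 'x::topological_space set"
  assumes "\<And>i. open (L i)" "(\<Union>i. L i) = UNIV" "compact K"
  obtains n where "\<And>i. i \<ge> n \<Longrightarrow> disjointed L i \<inter> K = {}" "K \<subseteq> (\<Union>i<n. disjointed L i)"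
proof -
  obtain I where I: "finite I" "K \<subseteq> (\<Union>i\<in>I. L i)"
    using compactE_image[OF assms(3), of UNIV L] assms(1,2) by auto
  obtain n where n: "I \<subseteq> {..<n}" using finite_nat_bounded[OF I(1)] by auto
  then have K: "K \<subseteq> (\<Union>i\<in>{0..<n}. L i)" using I(2) by force
  show ?thesis
  proof (rule that[of n])
    show "disjointed L i \<inter> K = {}" if "n \<le> i" for i
      using K that unfolding disjointed_def by force
    show "K \<subseteq> (\<Union>i<n. disjointed L i)"
      using K finite_UN_disjointed_eq[of L n] by (simp add: lessThan_atLeast0)
  qed
qed

context poisson_data
begin

lemma marked_poisson_exists:
  fixes L :: "nat \<Rightarrow> 'x set"
  assumes L: "\<And>i. L i \<in> Oc" and cover: "(\<Union>i. L i) = UNIV"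
  obtains M :: "('x, 'm) mconf measure"
  where "prob_space M" "sets M = sets mconf_space"
    "\<And>S. S \<in> Oc \<Longrightarrow> distr M (borel_of (mconf_topology S)) (mrestrict S) = marked_poisson_on \<sigma> \<tau> S"
proof -
  define C where "C = disjointed L"
  define M where "M i = marked_poisson_on \<sigma> \<tau> (L i)" for i
  interpret product_prob_space M UNIV
    using prob_space_marked_poisson_on[OF L] by (intro product_prob_spaceI) (simp add: M_def)
  let ?P = "PiM UNIV M" and ?\<Phi> = "superpose C"
  have C: "disjoint_family C" unfolding C_def by (rule disjoint_family_disjointed)
  have CL: "C i \<subseteq> L i" for i unfolding C_def by (rule disjointed_subset)
  have opL: "open (L i)" for i using L[of i] by (simp add: Oc_def)
  have loc: "finite {i. C i \<inter> K \<noteq> {}}" if "compact K" for K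
  proof -
    obtain n where n: "\<And>i. i \<ge> n \<Longrightarrow> C i \<inter> K = {}"
      using disjointed_locally_finite[OF opL cover \<open>compact K\<close>] unfolding C_def by metis
    then have "{i. C i \<inter> K \<noteq> {}} \<subseteq> {..<n}" by (metis (mono_tags) linorder_not_le lessThan_iff mem_Collect_eq subsetI)
    then show ?thesis using finite_subset by blast
  qed
  have space_P: "space ?P = (\<Pi>\<^sub>E i\<in>UNIV. mconfs (L i))"
    by (simp add: space_PiM M_def space_marked_poisson_on[OF L])
  have wL: "w i \<in> mconfs (L i)" if "w \<in> space ?P" for w i using that unfolding space_P by auto
  have \<Phi>: "?\<Phi> w \<in> mconfs UNIV" if "w \<in> space ?P" for w
    using wL[OF that] loc by (rule superpose_mconfs)
  have void: "?\<Phi> w \<in> voids UNIV B \<longleftrightarrow> (\<forall>i. w i \<in> voids (L i) (B \<inter> C i \<times> UNIV))" if "w \<in> space ?P" for w B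
    using \<Phi>[OF that] wL[OF that] unfolding voids_def mem_Collect_eq pts_superpose[OF C] by blast
  have C_borel: "C i \<times> UNIV \<in> sets (borel :: ('x \<times> 'm) measure)" for i
  proof -
    have "C i \<times> UNIV = L i \<times> (UNIV :: 'm set) - (\<Union>j\<in>{0..<i}. L j) \<times> UNIV"
      by (auto simp: C_def disjointed_def)
    then show ?thesis using opL by (simp add: open_Times open_UN sets.Diff)
  qed
  have voids_C: "voids (L i) (B \<inter> C i \<times> UNIV) \<in> sets (borel_of (mconf_topology (L i)))" if "open B" for B :: "('x \<times> 'm) set" and i
  proof -
    \<comment> \<open>A cell is an open set minus the earlier ones, so its part of an open test set
      is a difference of two open sets.\<close>
    have "B \<inter> C i \<times> UNIV = B \<inter> L i \<times> UNIV - (\<Union>j\<in>{0..<i}. L j) \<times> UNIV"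
      by (auto simp: C_def disjointed_def)
    then show ?thesis
      using voids_Diff_in_sets[OF L open_Int_strip[OF L that], of "(\<Union>j\<in>{0..<i}. L j) \<times> UNIV" i i] opL
      by (simp add: open_Times open_UN)
  qed
  then have voids_M: "voids (L i) (B \<inter> C i \<times> UNIV) \<in> sets (M i)" if "open B" for B :: "('x \<times> 'm) set" and i
    using that by (simp add: M_def sets_marked_poisson_on[OF L])
  have meas: "?\<Phi> \<in> ?P \<rightarrow>\<^sub>M mconf_space"
  proof (rule measurable_sigma_sets[OF sets_mconf_space local_voids_subset])
    show "?\<Phi> \<in> space ?P \<rightarrow> mconfs UNIV" using \<Phi> by auto
    fix V :: "('x, 'm) mconf set" assume "V \<in> local_voids"
    then obtain B where B: "V = voids UNIV B" "open B" by (auto simp: local_voids_def)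
    \<comment> \<open>The superposition avoids \<open>B\<close> iff each component avoids the part
      of \<open>B\<close> over its own cell: a countable intersection of one-coordinate
      events.\<close>
    have "?\<Phi> -` V \<inter> space ?P = (\<Inter>i. (\<lambda>w. w i) -` voids (L i) (B \<inter> C i \<times> UNIV) \<inter> space ?P)"
      (is "?X = ?Y")
    proof (intro set_eqI)
      fix w show "w \<in> ?X \<longleftrightarrow> w \<in> ?Y" by (cases "w \<in> space ?P") (simp_all add: B(1) void)
    qed
    also have "\<dots> \<in> sets ?P"
      using voids_M[OF B(2)] by (intro sets.countable_INT image_subsetI measurable_sets[OF measurable_component_singleton]) auto
    finally show "?\<Phi> -` V \<inter> space ?P \<in> sets ?P" .
  qed
  let ?M = "distr ?P mconf_space ?\<Phi>"
  show thesis
  proof (rule that[of ?M])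
    show "prob_space ?M" using meas by (rule prob_space_distr)
    show "sets ?M = sets mconf_space" by simp
    fix S :: "'x set" assume S: "S \<in> Oc"
    have mS: "mrestrict S \<in> ?M \<rightarrow>\<^sub>M borel_of (mconf_topology S)"
      using mrestrict_measurable_mconf_space[OF S] by simp
    show "distr ?M (borel_of (mconf_topology S)) (mrestrict S) = marked_poisson_on \<sigma> \<tau> S"
    proof (rule marked_poisson_on_eqI[OF S])
      fix B :: "('x \<times> 'm) set" assume "open B"
      define A where "A = B \<inter> S \<times> UNIV"
      have A: "open A" unfolding A_def using open_Int_strip[OF S \<open>open B\<close>] .
      have "voids UNIV A \<in> sets mconf_space"
        unfolding sets_mconf_space local_voids_def
        using A S by (intro sigma_sets.Basic) (auto simp: A_def)
      then have "emeasure (distr ?M (borel_of (mconf_topology S)) (mrestrict S)) (voids S B)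
          = emeasure ?P (?\<Phi> -` voids UNIV A \<inter> space ?P)"
        using emeasure_distr[OF mS voids_in_sets[OF S \<open>open B\<close>]] meas
        by (simp add: space_mconf_space mrestrict_vimage_voids emeasure_distr A_def)
      \<comment> \<open>Compactness of \<open>closure S\<close> bounds the cells involved. Beyond
        \<open>n\<close> the test set is empty and the event is certain, so what remains is a
        finite-dimensional rectangle.\<close>
      obtain n where n: "\<And>i. i \<ge> n \<Longrightarrow> C i \<inter> closure S = {}" "closure S \<subseteq> (\<Union>i<n. C i)"
        using disjointed_locally_finite[OF opL cover, of "closure S"] S unfolding C_def Oc_def by auto
      have SC: "S \<subseteq> (\<Union>i<n. C i)" "\<And>i. i \<ge> n \<Longrightarrow> S \<inter> C i = {}"
        using n closure_subset[of S] by (blast, blast)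
      have "A \<inter> C i \<times> UNIV = {}" if "i \<ge> n" for i
        using SC(2)[OF that] by (auto simp: A_def)
      then have "voids (L i) (A \<inter> C i \<times> UNIV) = mconfs (L i)" if "i \<ge> n" for i
        using that by (simp add: voids_empty)
      then have "w i \<in> voids (L i) (A \<inter> C i \<times> UNIV)" if "w \<in> space ?P" "\<not> i < n" for w i
        using wL[OF that(1), of i] that(2) by simp
      then have void_n: "?\<Phi> w \<in> voids UNIV A \<longleftrightarrow> (\<forall>i\<in>{..<n}. w i \<in> voids (L i) (A \<inter> C i \<times> UNIV))" if "w \<in> space ?P" for w
        using void[OF that] that by blast
      have "?\<Phi> -` voids UNIV A \<inter> space ?P = {w \<in> space ?P. \<forall>i\<in>{..<n}. w i \<in> voids (L i) (A \<inter> C i \<times> UNIV)}"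
        (is "?X = ?Y")
      proof (intro set_eqI)
        fix w show "w \<in> ?X \<longleftrightarrow> w \<in> ?Y" by (cases "w \<in> space ?P") (simp_all add: void_n)
      qed
      then have "emeasure ?P (?\<Phi> -` voids UNIV A \<inter> space ?P) = (\<Prod>i<n. emeasure (M i) (voids (L i) (A \<inter> C i \<times> UNIV)))"
        using voids_M[OF A] by (simp add: emeasure_PiM_Collect)
      also have "\<dots> = (\<Prod>i<n. ennreal (exp (- measure intensity (A \<inter> C i \<times> UNIV))))"
      proof (intro prod.cong refl)
        fix i
        \<comment> \<open>The cell lies inside \<open>L i\<close>, so the void formula over
          \<open>L i\<close> sees exactly the part of \<open>A\<close> over the cell, and nothing of
          the points that are trimmed away.\<close>
        have "A \<inter> C i \<times> UNIV \<inter> L i \<times> UNIV = A \<inter> C i \<times> UNIV" using CL[of i] by auto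
        then show "emeasure (M i) (voids (L i) (A \<inter> C i \<times> UNIV)) = ennreal (exp (- measure intensity (A \<inter> C i \<times> UNIV)))"
          using emeasure_marked_poisson_on_voids[OF L _ voids_C[OF A], of i] A C_borel[of i]
          by (simp add: M_def sets.Int)
      qed
      also have "\<dots> = ennreal (exp (- (\<Sum>i<n. measure intensity (A \<inter> C i \<times> UNIV))))"
        by (simp add: prod_ennreal exp_sum sum_negf[symmetric])
      also have "(\<Sum>i<n. measure intensity (A \<inter> C i \<times> UNIV)) = measure intensity (\<Union>i<n. A \<inter> C i \<times> UNIV)"
      proof (rule measure_finite_Union[symmetric])
        show "(\<lambda>i. A \<inter> C i \<times> UNIV) ` {..<n} \<subseteq> sets intensity"
          using A C_borel by (auto simp: sets_intensity)
        show "disjoint_family_on (\<lambda>i. A \<inter> C i \<times> UNIV) {..<n}"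
          using C by (auto simp: disjoint_family_on_def)
        show "emeasure intensity (A \<inter> C i \<times> UNIV) \<noteq> \<infinity>" for i
        proof -
          have "emeasure intensity (A \<inter> C i \<times> UNIV) \<le> emeasure intensity (L i \<times> UNIV)"
            using CL[of i] times_borel[OF L[of i]] by (intro emeasure_mono) (auto simp: sets_intensity)
          then show ?thesis using emeasure_position_finite[OF L[of i]] emeasure_strip[OF L[of i]] by auto
        qed
      qed simp
      also have "(\<Union>i<n. A \<inter> C i \<times> UNIV) = A" using SC(1) by (auto simp: A_def)
      finally show "emeasure (distr ?M (borel_of (mconf_topology S)) (mrestrict S)) (voids S B)
          = ennreal (exp (- measure intensity (B \<inter> S \<times> UNIV)))"
        using \<open>emeasure (distr ?M _ _) (voids S B) = _\<close> by (simp add: A_def)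
    qed simp
  qed
qed

end

section \<open>A countable cover by relatively compact open sets\<close>

lemma chart_Oc_neighbourhood:
  fixes c :: "('x::metric_space, 'n::finite) chart"
  assumes "is_chart c" "x \<in> fst c"
  obtains S where "S \<in> Oc" "x \<in> S"
proof -
  have o: "open (fst c)" "open (snd c ` fst c)"
    and h: "homeomorphism (fst c) (snd c ` fst c) (snd c) (chart_inv c)"
    using assms(1) by (auto simp: is_chart_def)
  obtain r where r: "r > 0" "cball (snd c x) r \<subseteq> snd c ` fst c"
    using o(2) assms(2) by (metis imageI open_contains_cball)
  \<comment> \<open>Local compactness is pulled back from Euclidean space: \<open>S\<close> is a
    small open coordinate ball, and the compact \<open>K\<close> is the closed ball carried back by
    the inverse chart, which contains \<open>S\<close> and is closed in the metric space.\<close>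
  define S where "S = fst c \<inter> snd c -` ball (snd c x) r"
  define K where "K = chart_inv c ` cball (snd c x) r"
  have "open S"
    unfolding S_def using homeomorphism_cont1[OF h] o(1) by (rule continuous_open_preimage) simp
  have "compact K"
    unfolding K_def using continuous_on_subset[OF homeomorphism_cont2[OF h] r(2)]
    by (rule compact_continuous_image) simp
  have "S \<subseteq> K"
  proof
    fix y assume "y \<in> S"
    then have "y = chart_inv c (snd c y)" "snd c y \<in> cball (snd c x) r"
      using h by (auto simp: S_def homeomorphism_def)
    then show "y \<in> K" unfolding K_def by blast
  qed
  then have "closure S \<subseteq> K" using \<open>compact K\<close> by (simp add: closure_minimal compact_imp_closed)
  then have "closure S = K \<inter> closure S" by blast
  then have "compact (closure S)" using compact_Int_closed[OF \<open>compact K\<close> closed_closure, of S] by simp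
  then have "S \<in> Oc" using \<open>open S\<close> by (simp add: Oc_def)
  moreover have "x \<in> S" using assms(2) r(1) by (simp add: S_def)
  ultimately show ?thesis by (rule that)
qed

text \<open>Charts cover the manifold by sets of \<open>Oc\<close>, and second countability
  (Lindelof) extracts a countable subcover, which the partition into cells needs as a
  sequence.\<close>

lemma countable_Oc_cover:
  fixes \<A> :: "('x::{metric_space, second_countable_topology}, 'n::finite) chart set"
  assumes "oriented_smooth_atlas \<A>"
  obtains L :: "nat \<Rightarrow> 'x set" where "\<And>i. L i \<in> Oc" "(\<Union>i. L i) = UNIV"
proof -
  have "\<exists>S. S \<in> Oc \<and> x \<in> S" for x :: 'x
  proof -
    obtain c where "c \<in> \<A>" "x \<in> fst c" using assms unfolding oriented_smooth_atlas_def by blast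
    then show ?thesis
      using assms chart_Oc_neighbourhood[of c x] unfolding oriented_smooth_atlas_def by metis
  qed
  then have U: "\<Union>Oc = (UNIV :: 'x set)" by blast
  obtain F where F: "F \<subseteq> Oc" "countable F" "\<Union>F = \<Union>(Oc :: 'x set set)"
    using Lindelof[of "Oc :: 'x set set"] by (auto simp: Oc_def)
  have "F \<noteq> {}" using F(3) U by auto
  then show ?thesis
    using F U by (intro that[of "from_nat_into F"]) (auto simp: range_from_nat_into from_nat_into subset_iff)
qed

theorem mainTheorem6:
  fixes \<A> :: "('x::{metric_space, second_countable_topology}, 'n::finite) chart set"
    and g :: "('x, 'n) chart \<Rightarrow> 'x \<Rightarrow> real^'n^'n"
    and \<sigma> :: "'x measure"
    and \<tau> :: "'m::polish_space measure"
  assumes "connected_oriented_riemannian_manifold \<A> g"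
    and "\<not> compact (UNIV :: 'x set)"
    and "radon_measure \<sigma>" and "non_atomic \<sigma>"
    and "prob_space \<tau>" and "sets \<tau> = sets borel"
  shows "(\<forall>\<Lambda>\<^sub>1\<in>Oc. \<forall>\<Lambda>\<^sub>2\<in>Oc. \<Lambda>\<^sub>1 \<subseteq> \<Lambda>\<^sub>2 \<longrightarrow>
            mrestrict \<Lambda>\<^sub>1 \<in> measurable (marked_poisson_on \<sigma> \<tau> \<Lambda>\<^sub>2) (borel_of (mconf_topology \<Lambda>\<^sub>1)) \<and>
            distr (marked_poisson_on \<sigma> \<tau> \<Lambda>\<^sub>2) (borel_of (mconf_topology \<Lambda>\<^sub>1)) (mrestrict \<Lambda>\<^sub>1)
              = marked_poisson_on \<sigma> \<tau> \<Lambda>\<^sub>1) \<and>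
         (\<exists>!\<mu> :: ('x, 'm) mconf measure.
            prob_space \<mu> \<and> sets \<mu> = sets mconf_space \<and>
            (\<forall>\<Lambda>\<in>Oc. distr \<mu> (borel_of (mconf_topology \<Lambda>)) (mrestrict \<Lambda>) = marked_poisson_on \<sigma> \<tau> \<Lambda>))"
proof -
  have \<sigma>: "sets \<sigma> = sets borel" "\<And>K. compact K \<Longrightarrow> emeasure \<sigma> K < \<infinity>"
    using assms(3) by (auto simp: radon_measure_def)
  have "emeasure \<sigma> {x} = 0" for x
  proof (rule ccontr)
    assume "emeasure \<sigma> {x} \<noteq> 0"
    \<comment> \<open>The only subsets of a singleton are itself and the empty set, so a point of
      positive mass would be an atom.\<close>
    then have "atom \<sigma> {x}"
      by (auto simp: atom_def \<sigma>(1) zero_less_iff_neq_zero subset_singleton_iff)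
    then show False using assms(4) by (auto simp: non_atomic_def)
  qed
  then interpret poisson_data \<sigma> \<tau>
    using \<sigma> assms(5,6) by (intro poisson_data.intro)
  obtain L :: "nat \<Rightarrow> 'x set" where L: "\<And>i. L i \<in> Oc" "(\<Union>i. L i) = UNIV"
    using countable_Oc_cover assms(1) unfolding connected_oriented_riemannian_manifold_def by metis
  obtain M :: "('x, 'm) mconf measure" where M: "prob_space M" "sets M = sets mconf_space"
    "\<And>S. S \<in> Oc \<Longrightarrow> distr M (borel_of (mconf_topology S)) (mrestrict S) = marked_poisson_on \<sigma> \<tau> S"
    by (rule marked_poisson_exists[OF L]) (rule that)
  show ?thesis
  proof (intro conjI ballI impI ex1I[of _ M])
    fix S T :: "'x set" assume "S \<in> Oc" "T \<in> Oc" "S \<subseteq> T"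
    then show "mrestrict S \<in> marked_poisson_on \<sigma> \<tau> T \<rightarrow>\<^sub>M borel_of (mconf_topology S)"
      "distr (marked_poisson_on \<sigma> \<tau> T) (borel_of (mconf_topology S)) (mrestrict S) = marked_poisson_on \<sigma> \<tau> S"
      by (rule marked_poisson_on_consistent)+
  next
    fix N :: "('x, 'm) mconf measure"
    assume N: "prob_space N \<and> sets N = sets mconf_space \<and>
      (\<forall>\<Lambda>\<in>Oc. distr N (borel_of (mconf_topology \<Lambda>)) (mrestrict \<Lambda>) = marked_poisson_on \<sigma> \<tau> \<Lambda>)"
    show "N = M" by (rule marked_poisson_unique) (use N M in auto)
  qed (use M in auto)
qed

end
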